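(* Let $\vec{\alpha}\in\mathbb{R}_+^d\setminus\{\vec{0}\}$. For any $\varepsilon>0$, there is $N\in\mathbb{N}$ such that if $\vec{\alpha}$ has a Brun expansion of length at least $N$, then any stepped surface in $\mathfrak{S}_{\vec{\alpha}}$ is at distance at most $\varepsilon$ (for $d_{\mathfrak{F}}$) from a stepped quasi-plane of normal vector $\vec{\alpha}$.
   Context: Fix an integer $d\geq 3$; $(\vec{e}_1,\ldots,\vec{e}_d)$ is the canonical basis of $\mathbb{R}^d$, $\langle\cdot|\cdot\rangle$ the standard scalar product, $\|\cdot\|$ the Euclidean norm, $\mathbb{R}_+$ the set of non-negative reals. A stepped function is a function $\mathcal{E}:\mathbb{Z}^d\times\{1,\ldots,d\}\to\mathbb{Z}$ (set $\mathfrak{F}$, pointwise operations and order); it is binary if it takes only the values $0$ and $1$ (set $\mathfrak{B}$). The face $(\vec{x},i^* )$ is the stepped function with value $1$ at $(\vec{x},i)$ and $0$ elsewhere. Distance: $d_{\mathfrak{F}}(\mathcal{E},\mathcal{E}')=0$ if $\mathcal{E}=\mathcal{E}'$, and otherwise $2^{-r}$ with $r$ the largest $n\in\mathbb{N}$ such that $\mathcal{E}(\vec{x},i)=\mathcal{E}'(\vec{x},i)$ for all $(\vec{x},i)$ with $\|\vec{x}\|<n$. The geometric interpretation of $\mathcal{B}\in\mathfrak{B}$ is the union, over all $(\vec{x},i)$ with $\mathcal{B}(\vec{x},i)=1$, of the facets $\{\vec{x}+\vec{e}_i+\sum_{j\neq i}\lambda_j\vec{e}_j \mid 0\leq\lambda_j\leq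 1\}$. Let $\pi$ be the orthogonal projection of $\mathbb{R}^d$ onto $\Delta=\{\vec{x} \mid x_1+\cdots+x_d=0\}$. A stepped surface is a binary stepped function whose geometric interpretation is homeomorphic to $\Delta$ under $\pi$ (i.e. the restriction of $\pi$ to it is a homeomorphism onto $\Delta$). The stepped plane $\mathcal{P}_{\vec{\alpha},\rho}$ ($\vec{\alpha}\in\mathbb{R}_+^d\setminus\{\vec{0}\}$, $\rho\in\mathbb{R}$) is the binary stepped function with $\mathcal{P}_{\vec{\alpha},\rho}(\vec{x},i)=1$ iff $\langle\vec{x}|\vec{\alpha}\rangle<\rho\leq\langle\vec{x}+\vec{e}_i|\vec{\alpha}\rangle$. The flip at $\vec{x}\in\mathbb{Z}^d$ is $\mathcal{F}_{\vec{x}}=\sum_{i=1}^d(\vec{x},i^* )-\sum_{i=1}^d(\vec{x}-\vec{e}_i,i^* )$. A stepped quasi-plane of normal vector $\vec{\alpha}$ is a stepped surface of the form $\mathcal{P}_{\vec{\alpha},\rho}+\sum_{\vec{x}\in D}\mathcal{F}_{\vec{x}}$ for some $\rho\in\mathbb{R}$ and some $D\subset\{\vec{x}\in\mathbb{Z}^d \mid \langle\vec{x}|\vec{\alpha}\rangle=\rho\}$. Brun expansion of a vector. Let $X=\mathbb{R}_+^d\setminus\{\vec{0}\}$ and $X_0=\{\lambda\vec{e}_i \mid \lambda>0,\ 1\leq i\leq d\}$. For $\vec{\alpha}\in X_0$ put $B(\vec{\alpha})=I_d$. For $\vec{\alpha}\in X\setminus X_0$, let $(i,j)$, $i\neq j$,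 be the lexicographically smallest pair with $\alpha_i=\max_k\alpha_k$ and $\alpha_j=\max_{k\neq i}\alpha_k$, let $a=\lfloor\alpha_i/\alpha_j\rfloor$, and let $B(\vec{\alpha})$ be the matrix with $(i,i)$-entry $a$, $(i,j)$- and $(j,i)$-entries $1$, $(j,j)$-entry $0$, $(k,k)$-entry $1$ for $k\notin\{i,j\}$, other entries $0$. Put $T(\vec{\alpha})=B(\vec{\alpha})^{-1}\vec{\alpha}$. The Brun expansion of $\vec{\alpha}$ is the sequence $(B_n)_{n\geq 1}$ with $B_n=B(T^{n-1}(\vec{\alpha}))$; its length is the smallest $n$ with $T^n(\vec{\alpha})\in X_0$, and it is infinite if there is no such $n$. Dual maps. $F_d$ is the free group on $\{1,\ldots,d\}$ (elements in reduced form); $\vec{f}:F_d\to\mathbb{Z}^d$ sends $w$ to the vector whose $i$-th entry is the sum of the exponents of $i$ in $w$. The incidence matrix $M_\sigma$ of an endomorphism $\sigma$ of $F_d$ has $i$-th column $\vec{f}(\sigma(i))$; $\sigma$ is unimodular if $\det M_\sigma=\pm1$. The dual map $E_1^*(\sigma):\mathfrak{F}\to\mathfrak{F}$ of a unimodular $\sigma$ is $$E_1^*(\sigma)(\mathcal{E})(\vec{x},i)=\sum_{\sigma(i)=p\cdot j\cdot s}\mathcal{E}(M_\sigma\vec{x}+\vec{f}(p),j)-\sum_{\sigma(i)=p\cdot j^{-1}\cdot s}\mathcal{E}(M_\sigma\vec{x}+\vec{f}(p)-\vec{e}_j,j),$$ the sums ranging over all occurrences in $\sigma(i)$ of letters $j$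 (resp. inverse letters $j^{-1}$), with $p$ the prefix before and $s$ the suffix after the occurrence. The Brun substitution $\beta_{a,i,j}$ ($a\in\mathbb{N}$, $i\neq j$) is the automorphism of $F_d$ with $\beta_{a,i,j}(i)=i^aj$, $\beta_{a,i,j}(j)=i$, $\beta_{a,i,j}(k)=k$ for $k\notin\{i,j\}$; its inverse satisfies $\beta_{a,i,j}^{-1}(i)=j$, $\beta_{a,i,j}^{-1}(j)=j^{-a}i$, $\beta_{a,i,j}^{-1}(k)=k$. Runs and the map $\tilde{T}$. For $i\neq j$ and $\mathcal{B}\in\mathfrak{B}$, an $(\vec{e}_j,i)$-run of $\mathcal{B}$ is a non-zero binary stepped function $\mathcal{R}=\sum_{k\in I}(\vec{x}+k\vec{e}_j,i^* )$, where $\vec{x}\in\mathbb{Z}^d$ and $I$ is maximal among the intervals of $\mathbb{Z}$ such that $\mathcal{R}\leq\mathcal{B}$; its length is $\#I$ (possibly infinite). Define $\tilde{T}:\mathfrak{B}\to\mathfrak{F}$ as follows. Suppose there are $i\neq j$ such that (1) for any $k\neq i$, all $(\vec{e}_i,k)$-runs and (when $k\neq j$) all $(\vec{e}_j,k)$-runs of $\mathcal{B}$, if any, have length $1$; (2) $\mathcal{B}$ has at least one finite $(\vec{e}_j,i)$-run. Take the lexicographically smallest such pair $(i,j)$, let $a$ be the length of the shortest $(\vec{e}_j,i)$-run of $\mathcal{B}$, and set $\tilde{T}(\mathcal{B})=E_1^*(\beta_{a,i,j}^{-1})(\mathcal{B})$. If there is no such pair, $\tilde{T}(\mathcal{B})=\mathcal{B}$.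 The map $\tilde{T}$ sends stepped surfaces to stepped surfaces, so it can be iterated on them. Brun expansion of a stepped surface $\mathcal{S}$: the sequence $(B_n)_{n\geq 1}$ where $B_n=I_d$ if $\tilde{T}^{n}(\mathcal{S})=\tilde{T}^{n-1}(\mathcal{S})$, and otherwise $B_n$ is the incidence matrix of the Brun substitution $\beta_n$ (the one chosen in the definition of $\tilde{T}$) such that $\tilde{T}^{n}(\mathcal{S})=E_1^*(\beta_n^{-1})(\tilde{T}^{n-1}(\mathcal{S}))$. $\mathfrak{S}_{\vec{\alpha}}$ denotes the set of stepped surfaces having the same Brun expansion as $\vec{\alpha}$. *)

theory Defs
  imports
    "HOL-Analysis.Analysis"
    "HOL-Algebra.Group"
    "HOL-Library.Function_Algebras"
    "HOL-Library.Extended_Nat"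
begin

text \<open>
  The index set $\{1,\dots,d\}$ is a type \<open>'d\<close> of class \<open>finite\<close>; the class \<open>wellorder\<close> (every
  finite linear order is one) is added where lexicographically smallest pairs of indices are
  chosen. The lattice $\mathbb{Z}^d$ is \<open>int^'d\<close>, with basis vectors \<open>axis i 1\<close>.
\<close>

definition rvec :: "int^'d \<Rightarrow> real^'d::finite" where
  "rvec x = (\<chi> i. of_int (x $ i))"

definition rmat :: "int^'d^'d \<Rightarrow> real^'d^'d::finite" where
  "rmat A = (\<chi> i j. of_int (A $ i $ j))"

definition lex_least :: "('d::wellorder \<Rightarrow> 'd \<Rightarrow> bool) \<Rightarrow> 'd \<times> 'd" where
  "lex_least P = (let i = (LEAST i. \<exists>j. P i j) in (i, LEAST j. P i j))"

lemma lex_least: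
  assumes "P i j" "lex_least P = (i', j')"
  shows "P i' j'" "i' < i \<or> i' = i \<and> j' \<le> j"
proof -
  have i': "i' = (LEAST i. \<exists>j. P i j)" and j': "j' = (LEAST j. P i' j)"
    using assms(2) by (auto simp: lex_least_def Let_def)
  have "\<exists>j. P i' j"
    unfolding i' using assms(1) by (intro LeastI[of "\<lambda>i. \<exists>j. P i j" i]) blast
  then show "P i' j'" unfolding j' by (metis LeastI)
  have "i' \<le> i" unfolding i' using assms(1) by (intro Least_le) blast
  moreover have "j' \<le> j" if "i' = i" unfolding j' using that assms(1) by (intro Least_le) simp
  ultimately show "i' < i \<or> i' = i \<and> j' \<le> j" by auto
qed


section \<open>Stepped functions\<close>

type_synonym 'd stepped = "(int, 'd) vec \<times> 'd \<Rightarrow> int"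

definition binary :: "'d::finite stepped \<Rightarrow> bool" where
  "binary \<E> \<longleftrightarrow> (\<forall>f. \<E> f \<in> {0, 1})"

definition face :: "int^'d \<Rightarrow> 'd \<Rightarrow> 'd::finite stepped" where
  "face x i = (\<lambda>f. if f = (x, i) then 1 else 0)"

text \<open>
  Sum of a possibly infinite family of stepped functions, only used for families such that, at
  each argument, all but finitely many members vanish (see \<open>finite_faces\<close> and
  \<open>finite_flips\<close> below).
\<close>

definition family_sum :: "'b set \<Rightarrow> ('b \<Rightarrow> 'd::finite stepped) \<Rightarrow> 'd stepped" where
  "family_sum A F = (\<lambda>f. \<Sum>a\<in>{a\<in>A. F a f \<noteq> 0}. F a f)"

definition flip :: "int^'d \<Rightarrow> 'd::finite stepped" where
  "flip x = (\<Sum>i\<in>UNIV. face x i) - (\<Sum>i\<in>UNIV. face (x - axis i 1) i)"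

definition dist_stepped :: "'d::finite stepped \<Rightarrow> 'd stepped \<Rightarrow> real" where
  "dist_stepped \<E> \<E>' =
    (if \<E> = \<E>' then 0
     else inverse (2 ^ (GREATEST n::nat. \<forall>x i. norm (rvec x) < real n \<longrightarrow> \<E> (x, i) = \<E>' (x, i))))"

definition diag_hyperplane :: "(real^'d::finite) set" where
  "diag_hyperplane = {x. (\<Sum>i\<in>UNIV. x $ i) = 0}"

definition diag_proj :: "real^'d::finite \<Rightarrow> real^'d" where
  "diag_proj x = x - ((\<Sum>i\<in>UNIV. x $ i) / real CARD('d)) *\<^sub>R 1"

lemma diag_proj_orthogonal_projection:
  fixes x :: "real^'d::finite"
  shows "diag_proj x \<in> diag_hyperplane"
    and "y \<in> diag_hyperplane \<Longrightarrow> (x - diag_proj x) \<bullet> y = 0"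
  by (simp_all add: diag_proj_def diag_hyperplane_def sum_subtractf inner_vec_def
      flip: sum_distrib_left sum_divide_distrib)

definition facet :: "int^'d \<Rightarrow> 'd \<Rightarrow> (real^'d::finite) set" where
  "facet x i = {rvec x + axis i 1 + (\<Sum>j\<in>UNIV - {i}. l j *\<^sub>R axis j 1) | l.
                  \<forall>j. 0 \<le> l j \<and> l j \<le> 1}"

definition geom :: "'d::finite stepped \<Rightarrow> (real^'d) set" where
  "geom \<B> = (\<Union>(x, i)\<in>{f. \<B> f = 1}. facet x i)"

definition stepped_surface :: "'d::finite stepped \<Rightarrow> bool" where
  "stepped_surface \<S> \<longleftrightarrow>
    binary \<S> \<and> (\<exists>g. homeomorphism (geom \<S>) diag_hyperplane diag_proj g)"

definition stepped_plane :: "real^'d \<Rightarrow> real \<Rightarrow> 'd::finite stepped" where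
  "stepped_plane \<alpha> \<rho> =
    (\<lambda>(x, i). if rvec x \<bullet> \<alpha> < \<rho> \<and> \<rho> \<le> rvec (x + axis i 1) \<bullet> \<alpha> then 1 else 0)"

definition stepped_quasi_plane :: "real^'d \<Rightarrow> 'd::finite stepped \<Rightarrow> bool" where
  "stepped_quasi_plane \<alpha> \<Q> \<longleftrightarrow> stepped_surface \<Q> \<and>
    (\<exists>\<rho> D. D \<subseteq> {x. rvec x \<bullet> \<alpha> = \<rho>} \<and> \<Q> = stepped_plane \<alpha> \<rho> + family_sum D flip)"


section \<open>Brun expansions of vectors\<close>

definition brun_matrix :: "nat \<Rightarrow> 'd \<Rightarrow> 'd \<Rightarrow> int^'d^'d::finite" where
  "brun_matrix a i j = (\<chi> k l.
     if k = i \<and> l = i then int a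
     else if k = i \<and> l = j \<or> k = j \<and> l = i then 1
     else if k = j \<and> l = j then 0
     else if k = l then 1 else 0)"

definition nonneg_vecs :: "(real^'d::finite) set" where
  "nonneg_vecs = {\<alpha>. \<forall>i. 0 \<le> \<alpha> $ i} - {0}"

definition axis_vecs :: "(real^'d::finite) set" where
  "axis_vecs = {c *\<^sub>R axis i 1 | c i. 0 < c}"

definition brun_vec_pair :: "real^'d \<Rightarrow> 'd \<Rightarrow> 'd::finite \<Rightarrow> bool" where
  "brun_vec_pair \<alpha> i j \<longleftrightarrow> i \<noteq> j \<and>
     \<alpha> $ i = Max (range (($) \<alpha>)) \<and> \<alpha> $ j = Max (($) \<alpha> ` (UNIV - {i}))"

definition brun_vec_B ::
  "real^'d::{finite,wellorder} \<Rightarrow> int^'d::{finite,wellorder}^'d::{finite,wellorder}" where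
  "brun_vec_B \<alpha> =
    (if \<alpha> \<in> axis_vecs then mat 1
     else let (i, j) = lex_least (brun_vec_pair \<alpha>) in brun_matrix (nat \<lfloor>\<alpha> $ i / \<alpha> $ j\<rfloor>) i j)"

definition brun_vec_T :: "real^'d::{finite,wellorder} \<Rightarrow> real^'d::{finite,wellorder}" where
  "brun_vec_T \<alpha> = matrix_inv (rmat (brun_vec_B \<alpha>)) *v \<alpha>"

text \<open>The expansion is a sequence indexed by the integers $n \ge 1$; index 0 is irrelevant.\<close>

definition brun_vec_expansion ::
  "real^'d::{finite,wellorder} \<Rightarrow> nat \<Rightarrow> int^'d::{finite,wellorder}^'d::{finite,wellorder}" where
  "brun_vec_expansion \<alpha> n = brun_vec_B ((brun_vec_T ^^ (n - 1)) \<alpha>)"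

definition brun_vec_length :: "real^'d::{finite,wellorder} \<Rightarrow> enat" where
  "brun_vec_length \<alpha> =
    (if \<exists>n. (brun_vec_T ^^ n) \<alpha> \<in> axis_vecs
     then enat (LEAST n. (brun_vec_T ^^ n) \<alpha> \<in> axis_vecs) else \<infinity>)"


section \<open>The free group and dual maps\<close>

text \<open>
  A word is a list of letters; \<open>(x, False)\<close> is the generator $x$ and \<open>(x, True)\<close> is $x^{-1}$. The
  free group consists of the reduced words, with concatenation followed by reduction as product.
\<close>

type_synonym 'a word = "('a \<times> bool) list"

definition letter_inv :: "'a \<times> bool \<Rightarrow> 'a \<times> bool" where
  "letter_inv l = (fst l, \<not> snd l)"

definition reduced :: "'a word \<Rightarrow> bool" where
  "reduced w \<longleftrightarrow> successively (\<lambda>l m. m \<noteq> letter_inv l) w"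

definition red_cons :: "'a \<times> bool \<Rightarrow> 'a word \<Rightarrow> 'a word" where
  "red_cons l w = (case w of [] \<Rightarrow> [l] | m # w' \<Rightarrow> if m = letter_inv l then w' else l # w)"

definition word_mult :: "'a word \<Rightarrow> 'a word \<Rightarrow> 'a word" where
  "word_mult u v = foldr red_cons u v"

definition word_inv :: "'a word \<Rightarrow> 'a word" where
  "word_inv w = rev (map letter_inv w)"

definition free_group :: "'a word monoid" where
  "free_group = \<lparr>carrier = {w. reduced w}, mult = word_mult, one = []\<rparr>"

text \<open>The endomorphism of the free group determined by the images \<open>g x\<close> of the generators.\<close>

definition free_extend :: "('a \<Rightarrow> 'b word) \<Rightarrow> 'a word \<Rightarrow> 'b word" where
  "free_extend g w = foldr (\<lambda>l. word_mult (if snd l then word_inv (g (fst l)) else g (fst l))) w []"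

definition abelianize :: "'d word \<Rightarrow> int^'d::finite" where
  "abelianize w = (\<chi> i. \<Sum>l\<leftarrow>w. if fst l = i then (if snd l then - 1 else 1) else 0)"

definition incidence_matrix :: "('d word \<Rightarrow> 'd word) \<Rightarrow> int^'d^'d::finite" where
  "incidence_matrix \<sigma> = (\<chi> k i. abelianize (\<sigma> [(i, False)]) $ k)"

text \<open>
  The dual map of \<open>\<sigma>\<close>; it is meant for unimodular \<open>\<sigma>\<close>, that is,
  \<open>det (incidence_matrix \<sigma>) \<in> {1, - 1}\<close>. The index \<open>n\<close> runs over the occurrences of letters in
  \<open>\<sigma>(i)\<close>, and \<open>take n w\<close> is the prefix before the occurrence.
\<close>

definition dual_map :: "('d word \<Rightarrow> 'd word) \<Rightarrow> 'd::finite stepped \<Rightarrow> 'd stepped" where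
  "dual_map \<sigma> \<E> = (\<lambda>(x, i). let w = \<sigma> [(i, False)]; M = incidence_matrix \<sigma> in
     \<Sum>n<length w. (case w ! n of
         (j, False) \<Rightarrow> \<E> (M *v x + abelianize (take n w), j)
       | (j, True) \<Rightarrow> - \<E> (M *v x + abelianize (take n w) - axis j 1, j)))"

definition brun_subst :: "nat \<Rightarrow> 'd \<Rightarrow> 'd \<Rightarrow> 'd word \<Rightarrow> 'd word" where
  "brun_subst a i j = free_extend (\<lambda>k.
     if k = i then replicate a (i, False) @ [(j, False)]
     else if k = j then [(i, False)] else [(k, False)])"

definition brun_subst_inv :: "nat \<Rightarrow> 'd \<Rightarrow> 'd \<Rightarrow> 'd word \<Rightarrow> 'd word" where
  "brun_subst_inv a i j = free_extend (\<lambda>k.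
     if k = i then [(j, False)]
     else if k = j then replicate a (j, True) @ [(i, False)] else [(k, False)])"


section \<open>Runs and Brun expansions of stepped surfaces\<close>

definition int_interval :: "int set \<Rightarrow> bool" where
  "int_interval I \<longleftrightarrow> (\<forall>a\<in>I. \<forall>b\<in>I. \<forall>c. a \<le> c \<and> c \<le> b \<longrightarrow> c \<in> I)"

definition segment :: "int^'d \<Rightarrow> 'd \<Rightarrow> 'd \<Rightarrow> int set \<Rightarrow> 'd::finite stepped" where
  "segment x j i I = family_sum I (\<lambda>k. face (x + k *s axis j 1) i)"

text \<open>\<open>is_run \<B> j i \<R> n\<close>: the stepped function \<open>\<R>\<close> is an $(\vec e_j,i)$-run of \<open>\<B>\<close>, of length \<open>n\<close>.\<close>

definition is_run :: "'d::finite stepped \<Rightarrow> 'd \<Rightarrow> 'd \<Rightarrow> 'd stepped \<Rightarrow> enat \<Rightarrow> bool" where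
  "is_run \<B> j i \<R> n \<longleftrightarrow> binary \<R> \<and> \<R> \<noteq> 0 \<and>
    (\<exists>x I. \<R> = segment x j i I \<and> int_interval I \<and> segment x j i I \<le> \<B> \<and>
       (\<forall>J. int_interval J \<and> segment x j i J \<le> \<B> \<and> I \<subseteq> J \<longrightarrow> J = I) \<and>
       n = (if finite I then enat (card I) else \<infinity>))"

definition brun_surf_pair :: "'d::finite stepped \<Rightarrow> 'd \<Rightarrow> 'd \<Rightarrow> bool" where
  "brun_surf_pair \<B> i j \<longleftrightarrow> i \<noteq> j \<and>
     (\<forall>k. k \<noteq> i \<longrightarrow>
        (\<forall>\<R> n. is_run \<B> i k \<R> n \<longrightarrow> n = 1) \<and>
        (k \<noteq> j \<longrightarrow> (\<forall>\<R> n. is_run \<B> j k \<R> n \<longrightarrow> n = 1))) \<and>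
     (\<exists>\<R> n. is_run \<B> j i \<R> (enat n))"

text \<open>
  The parameters $(a,i,j)$ of the Brun substitution that $\tilde T$ applies to \<open>\<B>\<close>, if any. Since
  some $(\vec e_j,i)$-run is finite, the shortest one is the shortest finite one.
\<close>

definition brun_choice :: "'d::{finite,wellorder} stepped \<Rightarrow> (nat \<times> 'd \<times> 'd) option" where
  "brun_choice \<B> =
    (if \<exists>i j. brun_surf_pair \<B> i j
     then let (i, j) = lex_least (brun_surf_pair \<B>) in
       Some (LEAST a. \<exists>\<R>. is_run \<B> j i \<R> (enat a), i, j)
     else None)"

definition brun_surf_T :: "'d::{finite,wellorder} stepped \<Rightarrow> 'd stepped" where
  "brun_surf_T \<B> = (case brun_choice \<B> of
     Some (a, i, j) \<Rightarrow> dual_map (brun_subst_inv a i j) \<B>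
   | None \<Rightarrow> \<B>)"

text \<open>
  As for vectors, only the indices $n \ge 1$ matter. The case \<open>None\<close> below is subsumed by the
  first alternative of the conditional.
\<close>

definition brun_surf_expansion ::
  "'d::{finite,wellorder} stepped \<Rightarrow> nat \<Rightarrow> int^'d::{finite,wellorder}^'d::{finite,wellorder}" where
  "brun_surf_expansion \<S> n =
    (let \<S>' = (brun_surf_T ^^ (n - 1)) \<S> in
     if brun_surf_T \<S>' = \<S>' then mat 1
     else case brun_choice \<S>' of
       Some (a, i, j) \<Rightarrow> incidence_matrix (brun_subst a i j)
     | None \<Rightarrow> mat 1)"

definition same_expansion_surfaces :: "real^'d::{finite,wellorder} \<Rightarrow> 'd stepped set" where
  "same_expansion_surfaces \<alpha> = {\<S>. stepped_surface \<S> \<and>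
     (\<forall>n\<ge>1. brun_surf_expansion \<S> n = brun_vec_expansion \<alpha> n)}"


section \<open>Sanity checks\<close>

lemma finite_faces:
  "finite {k. face (x + k *s axis j 1) i f \<noteq> 0}"
proof (rule finite_subset)
  show "{k. face (x + k *s axis j 1) i f \<noteq> 0} \<subseteq> {(fst f - x) $ j}"
    by (auto simp: face_def axis_def split: if_splits)
qed simp

lemma flip_apply:
  "flip x (y, i) = (if y = x then 1 else 0) - (if y = x - axis i 1 then 1 else 0)"
proof -
  have sum_apply: "(\<Sum>k\<in>A. F k) f = (\<Sum>k\<in>A. F k f)" if "finite A"
    for A and F :: "'a \<Rightarrow> 'a stepped" and f
    using that by (induction A rule: finite_induct) simp_all
  have "(\<Sum>k\<in>UNIV. face x k (y, i)) = (\<Sum>k\<in>UNIV. if k = i then if y = x then 1 else 0 else 0)"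
    by (intro sum.cong) (auto simp: face_def)
  moreover have "(\<Sum>k\<in>UNIV. face (x - axis k 1) k (y, i)) =
      (\<Sum>k\<in>UNIV. if k = i then if y = x - axis i 1 then 1 else 0 else 0)"
    by (intro sum.cong) (auto simp: face_def)
  ultimately show ?thesis
    by (simp add: flip_def sum_apply fun_diff_def)
qed

lemma finite_flips: "finite {x. flip x f \<noteq> 0}"
proof (rule finite_subset)
  show "{x. flip x f \<noteq> 0} \<subseteq> {fst f, fst f + axis (snd f) 1}"
    by (cases f) (auto simp: flip_apply split: if_splits)
qed simp

lemma letter_inv_inv [simp]: "letter_inv (letter_inv l) = l"
  by (simp add: letter_inv_def)

lemma letter_inv_neq [simp]: "letter_inv l \<noteq> l" "l \<noteq> letter_inv l"
  by (metis letter_inv_def snd_conv)+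

lemma reduced_simps [simp]:
  "reduced []" "reduced [l]"
  "reduced (l # m # w) \<longleftrightarrow> m \<noteq> letter_inv l \<and> reduced (m # w)"
  by (simp_all add: reduced_def)

lemma reduced_ConsD: "reduced (l # w) \<Longrightarrow> reduced w"
  by (cases w) auto

lemma reduced_red_cons: "reduced w \<Longrightarrow> reduced (red_cons l w)"
  by (cases w) (auto simp: red_cons_def dest: reduced_ConsD)

lemma red_cons_inv: "reduced w \<Longrightarrow> red_cons l (red_cons (letter_inv l) w) = w"
proof (cases w)
  case (Cons m v)
  then show "reduced w \<Longrightarrow> ?thesis"
    by (cases v) (auto simp: red_cons_def)
qed (simp add: red_cons_def)

lemma red_cons_reduced: "reduced (l # w) \<Longrightarrow> red_cons l w = l # w"
  by (cases w) (auto simp: red_cons_def)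

lemma word_mult_simps [simp]:
  "word_mult [] v = v" "word_mult (l # u) v = red_cons l (word_mult u v)"
  "word_mult (u @ u') v = word_mult u (word_mult u' v)"
  by (simp_all add: word_mult_def)

lemma reduced_word_mult: "reduced v \<Longrightarrow> reduced (word_mult u v)"
  by (induction u) (auto intro: reduced_red_cons)

lemma word_mult_red_cons:
  assumes "reduced v"
  shows "word_mult (red_cons l u) v = red_cons l (word_mult u v)"
proof (cases u)
  case (Cons m w)
  then show ?thesis
    using red_cons_inv[OF reduced_word_mult[OF assms, of w], of l] by (auto simp: red_cons_def)
qed (simp add: red_cons_def)

lemma word_mult_assoc:
  "reduced w \<Longrightarrow> word_mult (word_mult u v) w = word_mult u (word_mult v w)"
  by (induction u) (simp_all add: word_mult_red_cons)

lemma word_mult_Nil: "reduced w \<Longrightarrow> word_mult w [] = w"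
proof (induction w)
  case (Cons l w)
  then show ?case
    using red_cons_reduced[OF Cons.prems] reduced_ConsD[OF Cons.prems] by simp
qed simp

lemma word_inv_mult: "reduced v \<Longrightarrow> word_mult (word_inv u) (word_mult u v) = v"
proof (induction u)
  case (Cons l u)
  then show ?case
    using red_cons_inv[OF reduced_word_mult[OF Cons.prems, of u], of "letter_inv l"]
    by (simp add: word_inv_def)
qed (simp add: word_inv_def)

lemma word_inv_inv [simp]: "word_inv (word_inv u) = u"
  by (simp add: word_inv_def rev_map comp_def)

lemma group_free_group: "group (free_group :: 'a word monoid)"
proof (rule groupI)
  fix x :: "'a word" assume x: "x \<in> carrier free_group"
  show "\<exists>y\<in>carrier free_group. y \<otimes>\<^bsub>free_group\<^esub> x = \<one>\<^bsub>free_group\<^esub>"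
  proof
    have eq: "word_mult (word_mult (word_inv x) []) x = []"
      using x word_inv_mult[of "[]" x]
      by (simp add: free_group_def word_mult_assoc word_mult_Nil)
    show "word_mult (word_inv x) [] \<otimes>\<^bsub>free_group\<^esub> x = \<one>\<^bsub>free_group\<^esub>"
      using eq by (simp add: free_group_def)
    show "word_mult (word_inv x) [] \<in> carrier free_group"
      by (simp add: free_group_def reduced_word_mult)
  qed
qed (auto simp: free_group_def reduced_word_mult word_mult_assoc)

lemma reduced_free_extend: "reduced (free_extend g w)"
  by (induction w) (auto simp: free_extend_def intro: reduced_word_mult)

lemma free_extend_Nil: "free_extend g [] = []"
  by (simp add: free_extend_def)

lemma free_extend_Cons:
  "free_extend g (l # w) =
    word_mult (if snd l then word_inv (g (fst l)) else g (fst l)) (free_extend g w)"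
  by (simp add: free_extend_def)

lemma free_extend_generator: "reduced (g x) \<Longrightarrow> free_extend g [(x, False)] = g x"
  by (simp add: free_extend_def word_mult_Nil)

lemma free_extend_red_cons: "free_extend g (red_cons l w) = free_extend g (l # w)"
proof (cases w)
  case (Cons m v)
  show ?thesis
    using Cons word_inv_mult[OF reduced_free_extend, of "g (fst l)" g v]
      word_inv_mult[OF reduced_free_extend, of "word_inv (g (fst l))" g v]
    by (auto simp: red_cons_def free_extend_Cons letter_inv_def)
qed (simp add: red_cons_def)

lemma free_extend_mult:
  "free_extend g (word_mult u v) = word_mult (free_extend g u) (free_extend g v)"
  by (induction u)
    (simp_all add: free_extend_red_cons free_extend_Cons free_extend_Nil
      word_mult_assoc reduced_free_extend)

lemma free_extend_hom: "free_extend g \<in> hom free_group free_group"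
  by (auto simp: hom_def free_group_def reduced_free_extend free_extend_mult)

lemma free_extend_inv:
  assumes "\<And>x. free_extend g (h x) = [(x, False)]" and "reduced w"
  shows "free_extend g (free_extend h w) = w"
  using assms(2)
proof (induction w)
  case (Cons l w)
  have red: "reduced w" using Cons.prems by (rule reduced_ConsD)
  then have IH: "free_extend g (free_extend h w) = w" by (rule Cons.IH)
  have inv: "free_extend g (word_inv u) = word_mult (word_inv (free_extend g u)) []" for u
  proof -
    have "free_extend g (word_mult u (word_mult (word_inv u) [])) = []"
      using word_inv_mult[of "[]" "word_inv u"] by (simp add: free_extend_Nil)
    then have "word_mult (free_extend g u) (free_extend g (word_inv u)) = []"
      by (simp add: free_extend_mult word_mult_Nil reduced_free_extend free_extend_Nil)
    then show ?thesis
      using word_inv_mult[OF reduced_free_extend, of "free_extend g u" g "word_inv u"] by simp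
  qed
  have "word_mult (if snd l then word_inv [(fst l, False)] else [(fst l, False)]) w = l # w"
    using red_cons_reduced[OF Cons.prems] by (cases l) (auto simp: word_inv_def letter_inv_def)
  moreover have "word_mult (word_mult (word_inv u) []) w = word_mult (word_inv u) w" for u
    using red by (simp add: word_mult_assoc)
  ultimately show ?case
    by (simp add: free_extend_Cons free_extend_mult IH assms(1) inv split: if_splits)
qed (simp add: free_extend_Nil)

lemma free_extend_replicate:
  "free_extend g (replicate a (x, b) @ w) =
    ((word_mult (if b then word_inv (g x) else g x)) ^^ a) (free_extend g w)"
  by (induction a) (simp_all add: free_extend_Cons)

lemma brun_subst_inverse:
  assumes "i \<noteq> j" and w: "reduced w"
  shows "brun_subst_inv a i j (brun_subst a i j w) = w"
    and "brun_subst a i j (brun_subst_inv a i j w) = w"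
proof -
  let ?g = "\<lambda>k. if k = i then replicate a (i, False) @ [(j, False)]
     else if k = j then [(i, False)] else [(k, False)]"
  let ?h = "\<lambda>k. if k = i then [(j, False)]
     else if k = j then replicate a (j, True) @ [(i, False)] else [(k, False)]"
  have cancel: "word_mult [(k, b)] ((k, \<not> b) # v) = v" for k :: 'a and b v
    by (simp add: red_cons_def letter_inv_def)
  note cancel = cancel[of _ True, unfolded not_True_eq_False] cancel[of _ False, unfolded not_False_eq_True]
  have *: "(word_mult [(j, False)] ^^ a) (replicate a (j, True) @ [(i, False)]) = [(i, False)]"
  proof (induction a)
    case (Suc a)
    then show ?case
      by (simp add: funpow_Suc_right cancel del: funpow.simps word_mult_simps(2))
  qed simp
  have **: "(word_mult [(i, True)] ^^ a) (replicate a (i, False) @ [(j, False)]) = [(j, False)]"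
  proof (induction a)
    case (Suc a)
    then show ?case
      by (simp add: funpow_Suc_right cancel del: funpow.simps word_mult_simps(2))
  qed simp
  have red: "reduced (replicate a (k, b) @ [(l, c)])" if "k \<noteq> l" for k l :: 'a and b c
  proof (induction a)
    case (Suc a)
    then show ?case using that by (cases a) (auto simp: letter_inv_def)
  qed simp
  have red1: "word_mult (replicate a (j, True) @ [(i, False)]) [] =
      replicate a (j, True) @ [(i, False)]"
    using \<open>i \<noteq> j\<close> by (intro word_mult_Nil red) simp
  have red2: "word_mult (replicate a (i, False) @ [(j, False)]) [] =
      replicate a (i, False) @ [(j, False)]"
    using \<open>i \<noteq> j\<close> by (intro word_mult_Nil red)
  have "free_extend ?h (?g k) = [(k, False)]" for k
    using \<open>i \<noteq> j\<close> * red1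
    by (auto simp: free_extend_replicate free_extend_Cons free_extend_Nil word_mult_Nil
        simp del: word_mult_simps(2,3))
  then show "brun_subst_inv a i j (brun_subst a i j w) = w"
    unfolding brun_subst_def brun_subst_inv_def by (intro free_extend_inv w)
  have "free_extend ?g (?h k) = [(k, False)]" for k
    using \<open>i \<noteq> j\<close> ** red2
    by (auto simp: free_extend_replicate free_extend_Cons free_extend_Nil word_mult_Nil
        word_inv_def letter_inv_def simp del: word_mult_simps(2,3))
  then show "brun_subst a i j (brun_subst_inv a i j w) = w"
    unfolding brun_subst_def brun_subst_inv_def by (intro free_extend_inv w)
qed

end

theory Submission
  imports Defs
begin

text \<open>
  A stepped surface is the boundary of a set $A \subseteq \mathbb{Z}^d$ that is closed under
  subtracting basis vectors: the face $(\vec x, i^*)$ belongs to the surface iff $\vec x \in A$ and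
  $\vec x + \vec e_i \notin A$. Under this encoding a dual map becomes the preimage of $A$ under the
  incidence matrix, and the conditions on runs say that $A$ is closed under adding
  $\vec e_k - \vec e_i$, $\vec e_k - \vec e_j$ and $a \vec e_j - \vec e_i$.

  The bound $N$ may depend on $\vec\alpha$, so only infinite expansions matter, and for these every
  surface in $\mathfrak{S}_{\vec\alpha}$ is itself a quasi-plane: $\vec x \in A$ and
  $\vec y \notin A$ imply
  $\langle \vec x | \vec\alpha \rangle \le \langle \vec y | \vec\alpha \rangle$. Otherwise
  $\vec v = \vec x - \vec y$ has a positive scalar product with $\vec\alpha$, and the weak
  convergence of the Brun algorithm makes the entries of $B_n \cdots B_1 \vec v$ large on the
  support of the $n$-th remainder. This puts $-B_n \cdots B_1 \vec v$ among the directions under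
  which the $n$-th set is closed, so $\vec y \in A$.
\<close>

section \<open>Stepped surfaces as boundaries of down-closed sets\<close>

text \<open>A difference of indicators telescopes along lattice paths and is additive over disjoint
  unions; for \<open>A = {x}\<close> it is the flip at \<open>x\<close>.\<close>

definition stepped_of :: "(int^'d) set \<Rightarrow> 'd::finite stepped" where
  "stepped_of A = (\<lambda>(x, i). of_bool (x \<in> A) - of_bool (x + axis i 1 \<in> A))"

definition recession :: "(int^'d::finite) set \<Rightarrow> (int^'d) set" where
  "recession A = {u. \<forall>x\<in>A. x + u \<in> A}"

definition down_closed :: "(int^'d::finite) set \<Rightarrow> bool" where
  "down_closed A \<longleftrightarrow> (\<forall>i. - axis i 1 \<in> recession A)"

lemma rvec_nth [simp]: "rvec x $ i = of_int (x $ i)"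
  by (simp add: rvec_def)

lemma mem_facet_iff:
  "z \<in> facet x i \<longleftrightarrow> z $ i = of_int (x $ i) + 1 \<and>
     (\<forall>k. k \<noteq> i \<longrightarrow> of_int (x $ k) \<le> z $ k \<and> z $ k \<le> of_int (x $ k) + 1)" (is "_ \<longleftrightarrow> ?R")
proof -
  have comp: "(rvec x + axis i 1 + (\<Sum>j\<in>UNIV - {i}. l j *\<^sub>R axis j 1)) $ k =
      of_int (x $ k) + (if k = i then 1 else l k)" for l k
  proof -
    have "(\<Sum>j\<in>UNIV - {i}. l j *\<^sub>R axis j 1 :: real^'a) $ k =
        (\<Sum>j\<in>UNIV - {i}. if j = k then l k else 0)"
      unfolding sum_component by (rule sum.cong) (auto simp: axis_def)
    also have "\<dots> = (if k = i then 0 else l k)" by simp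
    finally show ?thesis by (simp add: axis_def)
  qed
  show ?thesis
  proof
    assume "z \<in> facet x i"
    then obtain l where "z = rvec x + axis i 1 + (\<Sum>j\<in>UNIV - {i}. l j *\<^sub>R axis j 1)"
      and "\<forall>j. 0 \<le> l j \<and> l j \<le> (1::real)"
      unfolding facet_def by blast
    then show ?R by (simp only: comp) simp
  next
    assume R: ?R
    define l where "l = (\<lambda>k. if k = i then 0 else z $ k - of_int (x $ k))"
    have "z = rvec x + axis i 1 + (\<Sum>j\<in>UNIV - {i}. l j *\<^sub>R axis j 1)"
      using R by (subst vec_eq_iff) (simp only: comp, simp add: l_def)
    moreover have "\<forall>j. 0 \<le> l j \<and> l j \<le> 1"
      using R by (simp add: l_def algebra_simps)
    ultimately show "z \<in> facet x i" unfolding facet_def by blast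
  qed
qed

section \<open>The height function of a stepped surface\<close>

lemma Ints_valued_constant:
  fixes f :: "real \<Rightarrow> real"
  assumes "continuous_on {0<..<1} f" "\<And>t. t \<in> {0<..<1} \<Longrightarrow> f t \<in> \<int>"
  obtains c where "\<And>t. t \<in> {0<..<1} \<Longrightarrow> f t = c"
proof -
  have "f constant_on {0<..<1}"
  proof (rule continuous_discrete_range_constant[OF _ assms(1)])
    fix x :: real assume x: "x \<in> {0<..<1}"
    have "1 \<le> norm (f y - f x)" if y: "y \<in> {0<..<1}" "f y \<noteq> f x" for y
      using assms(2)[OF x] assms(2)[OF y(1)] y(2)
      by (metis Ints_diff Ints_nonzero_abs_ge1 eq_iff_diff_eq_0 real_norm_def)
    then show "\<exists>e>0. \<forall>y. y \<in> {0<..<1} \<and> f y \<noteq> f x \<longrightarrow> e \<le> norm (f y - f x)"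
      by (intro exI[of _ 1]) auto
  qed simp
  then show thesis using that unfolding constant_on_def by blast
qed

text \<open>If \<open>f t\<close> and \<open>f t - t\<close> were both integers, so would be
  \<open>t\<close>, which is impossible in the open unit interval. The two cases thus split a
  connected interval into disjoint relatively closed sets, one of which is empty. Continuity extends
  the result to the end points.\<close>

lemma constant_or_slope_one:
  fixes f :: "real \<Rightarrow> real"
  assumes cont: "continuous_on {0..1} f"
    and vals: "\<And>t. t \<in> {0<..<1} \<Longrightarrow> f t \<in> \<int> \<or> f t - t \<in> \<int>"
  shows "(\<forall>t\<in>{0..1}. f t = f 0) \<or> (\<forall>t\<in>{0..1}. f t = f 0 + t)"
proof -
  have cont': "continuous_on {0<..<1} f" "continuous_on {0<..<1} (\<lambda>t. f t - t)"
    by (auto intro!: continuous_intros continuous_on_subset[OF cont])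
  let ?U = "{0<..<1} \<inter> f -` \<int>" and ?V = "{0<..<1} \<inter> (\<lambda>t. f t - t) -` \<int>"
  have extend: "\<forall>t\<in>{0..1}. g t = g 0"
    if g: "continuous_on {0..1} g" and c: "\<And>t. t \<in> {0<..<1} \<Longrightarrow> g t = c" for g :: "real \<Rightarrow> real" and c
  proof -
    have "g t = c" if "t \<in> {0..1}" for t
      by (rule continuous_constant_on_closure[of "{0<..<1}" g c t])
        (use that g c in \<open>simp_all add: closure_greaterThanLessThan\<close>)
    then show ?thesis by simp
  qed
  have disj: "?U \<inter> ?V = {}"
  proof (rule ccontr)
    assume "?U \<inter> ?V \<noteq> {}"
    then obtain t where t: "0 < t" "t < 1" "f t \<in> \<int>" "f t - t \<in> \<int>" by auto
    then have "t \<in> \<int>" using Ints_diff[OF t(3,4)] by simp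
    then show False using t by (auto elim!: Ints_cases)
  qed
  have "closedin (top_of_set {0<..<1}) ?U" "closedin (top_of_set {0<..<1}) ?V"
    by (intro continuous_closedin_preimage cont' closed_Ints)+
  moreover have UV: "?U \<union> ?V = {0<..<1}"
  proof (intro equalityI subsetI)
    fix t :: real assume "t \<in> {0<..<1}"
    then show "t \<in> ?U \<union> ?V" using vals[of t] by simp
  qed auto
  moreover have "connected {0<..<1::real}" by simp
  ultimately have "\<not> (?U \<noteq> {} \<and> ?V \<noteq> {})"
    using disj unfolding connected_closedin_eq by blast
  then consider "?U = {0<..<1}" | "?V = {0<..<1}" using UV by auto
  then show ?thesis
  proof cases
    case 1
    have "f t \<in> \<int>" if "t \<in> {0<..<1}" for t
      using that by (subst (asm) 1[symmetric]) simp
    then obtain c where "\<And>t. t \<in> {0<..<1} \<Longrightarrow> f t = c" using Ints_valued_constant[OF cont'(1)] by metis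
    then have "\<forall>t\<in>{0..1}. f t = f 0" by (rule extend[OF cont])
    then show ?thesis ..
  next
    case 2
    have "f t - t \<in> \<int>" if "t \<in> {0<..<1}" for t
      using that by (subst (asm) 2[symmetric]) simp
    then obtain c where c: "\<And>t. t \<in> {0<..<1} \<Longrightarrow> f t - t = c"
      using Ints_valued_constant[OF cont'(2)] by metis
    have "\<forall>t\<in>{0..1}. f t - t = f 0 - 0"
      by (rule extend[OF _ c]) (auto intro!: continuous_intros cont)
    then have "\<forall>t\<in>{0..1}. f t = f 0 + t" by (simp only: diff_0_right diff_eq_eq)
    then show ?thesis ..
  qed
qed

text \<open>The surface is a continuous graph over the diagonal hyperplane, so every point has a
  signed height above it in the all-ones direction. The lattice points of negative height form
  \<open>A\<close>; it is down-closed because the height has slope 0 or 1 along each lattice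
  edge.\<close>

lemma stepped_surface_lower_set:
  fixes \<S> :: "'d::finite stepped"
  assumes "stepped_surface \<S>"
  obtains A where "down_closed A" "A \<noteq> {}" "A \<noteq> UNIV" "\<S> = stepped_of A"
proof -
  obtain g where hom: "homeomorphism (geom \<S>) diag_hyperplane diag_proj g"
    and bin: "binary \<S>"
    using assms unfolding stepped_surface_def by blast
  define c where "c = (\<lambda>z::real^'d. (\<Sum>i\<in>UNIV. z $ i) / real CARD('d))"
  have proj: "diag_proj z = z - c z *\<^sub>R 1" for z
    by (simp add: diag_proj_def c_def)
  have c_shift: "c (z + t *\<^sub>R 1) = c z + t" for z t
    by (simp add: c_def sum.distrib field_simps)
  have proj_in: "diag_proj z \<in> diag_hyperplane" for z :: "real^'d"
    by (rule diag_proj_orthogonal_projection)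
  \<comment> \<open>\<open>g (diag_proj z)\<close> is the surface point on the diagonal line through
    \<open>z\<close>, and \<open>c\<close> is the coordinate along that line.\<close>
  define H where "H = (\<lambda>z. c z - c (g (diag_proj z)))"
  have H_in: "z - H z *\<^sub>R 1 \<in> geom \<S>" for z
  proof -
    have "diag_proj (g (diag_proj z)) = diag_proj z"
      using hom proj_in by (simp add: homeomorphism_def)
    then have "z - H z *\<^sub>R 1 = g (diag_proj z)"
      unfolding proj H_def by (simp add: algebra_simps)
    then show ?thesis using hom proj_in unfolding homeomorphism_def by blast
  qed
  have H_0: "H z = 0" if "z \<in> geom \<S>" for z
    using hom that by (simp add: H_def homeomorphism_def)
  have H_shift: "H (z + t *\<^sub>R 1) = H z + t" for z t
    by (simp add: H_def proj c_shift algebra_simps)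
  have H_cont: "continuous_on UNIV H"
  proof -
    have c: "continuous_on X c" for X
      unfolding c_def by (intro continuous_intros) simp
    then have p: "continuous_on UNIV (diag_proj :: real^'d \<Rightarrow> _)"
      unfolding proj by (intro continuous_intros)
    have "continuous_on UNIV (\<lambda>z. g (diag_proj z))"
      using hom proj_in
      by (intro continuous_on_compose2[OF _ p, of diag_hyperplane]) (auto simp: homeomorphism_def)
    then have "continuous_on UNIV (\<lambda>z. c (g (diag_proj z)))"
      by (intro continuous_on_compose2[OF c[of UNIV]]) auto
    then show ?thesis unfolding H_def using c by (intro continuous_intros)
  qed
  have facetE: "\<exists>x i. \<S> (x, i) = 1 \<and> z \<in> facet x i" if "z \<in> geom \<S>" for z
    using that unfolding geom_def by auto
  have facetI: "z \<in> geom \<S>" if "\<S> (x, i) = 1" "z \<in> facet x i" for z x i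
    using that unfolding geom_def by auto
  have H_int: "H (rvec x) \<in> \<int>" for x
  proof -
    obtain y i where "rvec x - H (rvec x) *\<^sub>R 1 \<in> facet y i" using facetE[OF H_in] by blast
    then have "H (rvec x) = of_int (x $ i - y $ i - 1)" by (simp add: mem_facet_iff)
    then show ?thesis by (simp only: Ints_of_int)
  qed
  \<comment> \<open>An interior point of a lattice edge can be moved along the diagonal to a facet only by an
    integer, or by the amount that makes the coordinate along the edge an integer.\<close>
  have edge: "(\<forall>t\<in>{0..1}. H (rvec x + axis i t) = H (rvec x)) \<or>
      (\<forall>t\<in>{0..1}. H (rvec x + axis i t) = H (rvec x) + t)" for x and i :: 'd
  proof -
    let ?f = "\<lambda>t. H (rvec x + t *\<^sub>R axis i 1)"
    have "axis i t = t *\<^sub>R axis i 1" for t :: real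
      by (simp add: vec_eq_iff axis_def)
    then have f: "H (rvec x + axis i t) = ?f t" for t by metis
    have f0: "?f 0 = H (rvec x)" by simp
    have "continuous_on {0..1} ?f"
      by (intro continuous_on_compose2[OF H_cont] continuous_intros) auto
    moreover have "?f t \<in> \<int> \<or> ?f t - t \<in> \<int>" for t
    proof -
      obtain y k where "rvec x + t *\<^sub>R axis i 1 - ?f t *\<^sub>R 1 \<in> facet y k"
        using facetE[OF H_in] by blast
      then have eq: "of_int (x $ k) + t * axis i 1 $ k - ?f t = of_int (y $ k) + 1"
        by (simp add: mem_facet_iff)
      show ?thesis
      proof (cases "k = i")
        case True
        then have "?f t - t = of_int (x $ k - y $ k - 1)" using eq by simp
        then show ?thesis by (metis Ints_of_int)
      next
        case False
        then have "?f t = of_int (x $ k - y $ k - 1)" using eq by (simp add: axis_def)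
        then show ?thesis by (metis Ints_of_int)
      qed
    qed
    ultimately have "(\<forall>t\<in>{0..1}. ?f t = ?f 0) \<or> (\<forall>t\<in>{0..1}. ?f t = ?f 0 + t)"
      by (intro constant_or_slope_one)
    then show ?thesis unfolding f f0 .
  qed
  have rvec_axis: "rvec (x + axis i 1) = rvec x + axis i 1" for x and i :: 'd
    by (simp add: vec_eq_iff axis_def)
  have step: "H (rvec (x + axis i 1)) = H (rvec x) \<or> H (rvec (x + axis i 1)) = H (rvec x) + 1"
    for x and i :: 'd
    using edge[of x i] unfolding rvec_axis by auto
  define A where "A = {x. H (rvec x) < 0}"
  have "down_closed A"
    unfolding down_closed_def recession_def
  proof (intro allI CollectI ballI)
    fix i and x :: "int^'d" assume "x \<in> A"
    then show "x + - axis i 1 \<in> A"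
      using step[of "x - axis i 1" i] by (auto simp: A_def)
  qed
  moreover have "A \<noteq> {} \<and> A \<noteq> UNIV"
  proof -
    obtain m where m: "H (rvec 0) = of_int m" using H_int Ints_cases by blast
    have "H (rvec (vec l)) = of_int (m + l)" for l
    proof -
      have "rvec (vec l) = rvec (0::int^'d) + of_int l *\<^sub>R 1" by (simp add: vec_eq_iff)
      then show ?thesis by (simp add: H_shift m)
    qed
    then have "vec (- m - 1) \<in> A" "vec (- m) \<notin> A" by (simp_all add: A_def)
    then show ?thesis by blast
  qed
  moreover have "\<S> = stepped_of A"
  proof (rule ext, clarify)
    fix x :: "int^'d" and i
    show "\<S> (x, i) = stepped_of A (x, i)"
    proof (cases "\<S> (x, i) = 1")
      case True
      \<comment> \<open>The two opposite corners of the facet of \<open>(x, i)\<close> fix the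
        heights of \<open>x\<close> and of \<open>x + axis i 1\<close> as -1 and 0.\<close>
      have "rvec x + axis i 1 \<in> geom \<S>"
        by (rule facetI[OF True]) (simp add: mem_facet_iff axis_def)
      then have 1: "H (rvec (x + axis i 1)) = 0" by (simp add: rvec_axis H_0)
      have "rvec x + 1 *\<^sub>R 1 \<in> geom \<S>"
        by (rule facetI[OF True]) (simp add: mem_facet_iff)
      then have "H (rvec x) + 1 = 0" using H_0 H_shift by metis
      then show ?thesis using 1 True by (simp add: stepped_of_def A_def)
    next
      case False
      then have S0: "\<S> (x, i) = 0" using bin unfolding binary_def by blast
      have "x \<in> A \<longleftrightarrow> x + axis i 1 \<in> A"
      proof (rule ccontr)
        assume "\<not> ?thesis"
        then have lt: "H (rvec x) < 0" "H (rvec (x + axis i 1)) \<ge> 0"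
          using step[of x i] by (auto simp: A_def)
        obtain m where m: "H (rvec x) = of_int m" using H_int Ints_cases by blast
        have "m = -1" using lt step[of x i] m by auto
        then have m1: "H (rvec x) = -1" using m by simp
        \<comment> \<open>Halfway along the edge the height is -1/2, so half a diagonal step leads
          to the surface. The point reached is the centre of the facet of \<open>(x, i)\<close>:
          coordinate \<open>i\<close> is an integer and the others are half-integers, so no other
          facet contains it.\<close>
        then have "H (rvec x + axis i (1/2)) = - (1/2)"
          using edge[of x i] lt by (auto simp: rvec_axis)
        then have "rvec x + axis i (1/2) + (1/2) *\<^sub>R 1 \<in> geom \<S>"
          using H_in[of "rvec x + axis i (1/2)"] by simp
        then obtain y k where yk: "\<S> (y, k) = 1"
          and f: "rvec x + axis i (1/2) + (1/2) *\<^sub>R 1 \<in> facet y k"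
          using facetE by blast
        have "k = i"
        proof (rule ccontr)
          assume "k \<noteq> i"
          then have "of_int (x $ k) + 1/2 = (of_int (y $ k) + 1 :: real)"
            using f by (simp add: mem_facet_iff axis_def)
          then have "of_int (2 * x $ k - 2 * y $ k) = (of_int 1 :: real)" by simp
          then have "2 * x $ k - 2 * y $ k = 1" by (simp only: of_int_eq_iff)
          then show False by presburger
        qed
        have "y $ l = x $ l" for l
        proof (cases "l = i")
          case True
          then show ?thesis using f \<open>k = i\<close> by (simp add: mem_facet_iff axis_def)
        next
          case False
          then have "of_int (y $ l) \<le> of_int (x $ l) + (1/2::real)"
            "of_int (x $ l) + 1/2 \<le> of_int (y $ l) + (1::real)"
            using f \<open>k = i\<close> by (simp_all add: mem_facet_iff axis_def)
          then show ?thesis by linarith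
        qed
        then have "y = x" by (simp add: vec_eq_iff)
        then show False using yk \<open>k = i\<close> False by simp
      qed
      then show ?thesis using S0 by (simp add: stepped_of_def)
    qed
  qed
  ultimately show thesis using that by blast
qed

section \<open>Dual maps and Brun matrices\<close>

lemma recession_zero: "0 \<in> recession A"
  by (simp add: recession_def)

lemma recession_add: "u \<in> recession A \<Longrightarrow> v \<in> recession A \<Longrightarrow> u + v \<in> recession A"
  by (simp add: recession_def flip: add.assoc)

lemma recession_sum: "(\<And>k. k \<in> K \<Longrightarrow> f k \<in> recession A) \<Longrightarrow> sum f K \<in> recession A"
  by (induction K rule: infinite_finite_induct) (auto intro: recession_zero recession_add)

lemma recession_scale: "u \<in> recession A \<Longrightarrow> int n *s u \<in> recession A"
  by (induction n) (auto simp: recession_zero recession_add vector_sadd_rdistrib)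

lemma recessionD: "u \<in> recession A \<Longrightarrow> x \<in> A \<Longrightarrow> x + u \<in> A"
  by (simp add: recession_def)

lemma down_closed_recession:
  assumes "down_closed A" "\<And>k. u $ k \<le> 0"
  shows "u \<in> recession A"
proof -
  have "(\<Sum>k\<in>UNIV. int (nat (- u $ k)) *s (- axis k 1)) \<in> recession A"
    using assms(1) by (intro recession_sum recession_scale) (simp add: down_closed_def)
  also have "(\<Sum>k\<in>UNIV. int (nat (- u $ k)) *s (- axis k 1)) = u"
  proof (subst vec_eq_iff, intro allI)
    fix l
    have "(\<Sum>k\<in>UNIV. int (nat (- u $ k)) *s (- axis k 1)) $ l =
        (\<Sum>k\<in>UNIV. if k = l then u $ l else 0)"
      unfolding sum_component using assms(2) by (intro sum.cong) (auto simp: axis_def)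
    then show "(\<Sum>k\<in>UNIV. int (nat (- u $ k)) *s (- axis k 1)) $ l = u $ l" by simp
  qed
  finally show ?thesis .
qed

lemma down_closedD:
  assumes "down_closed A" "x \<in> A" "\<And>k. y $ k \<le> x $ k"
  shows "y \<in> A"
  using recessionD[OF down_closed_recession[OF assms(1), of "y - x"] assms(2)] assms(3) by simp

section \<open>Linear algebra of Brun substitutions and their dual maps\<close>

lemma abelianize_simps [simp]:
  "abelianize [] = 0"
  "abelianize (u @ v) = abelianize u + abelianize v"
  "abelianize [(i, b)] = axis i (if b then - 1 else 1)"
  by (simp_all add: abelianize_def vec_eq_iff axis_def)

lemma abelianize_replicate [simp]:
  "abelianize (replicate n (i, b)) = axis i (if b then - int n else int n)"
proof (induction n)
  case (Suc n)
  then have "abelianize ((i, b) # replicate n (i, b)) =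
      axis i (if b then - 1 else 1) + axis i (if b then - int n else int n)"
    using abelianize_simps(2)[of "[(i, b)]" "replicate n (i, b)"] by simp
  then show ?case by (simp add: vec_eq_iff axis_def)
qed (simp add: vec_eq_iff axis_def)

lemma matrix_mult_axis:
  fixes A :: "'a::comm_semiring_1^'n^'m"
  shows "A *v axis k c = c *s column k A"
proof -
  have "(A *v axis k c) $ l = (\<Sum>m\<in>UNIV. if m = k then c * A $ l $ k else 0)" for l
    unfolding matrix_vector_mult_def vec_lambda_beta
    by (intro sum.cong) (auto simp: axis_def mult.commute)
  then show ?thesis by (simp add: vec_eq_iff column_def)
qed

lemma incidence_matrix_mult_axis:
  "incidence_matrix \<sigma> *v axis i 1 = abelianize (\<sigma> [(i, False)])"
  by (simp add: matrix_mult_axis column_def incidence_matrix_def vec_eq_iff)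

text \<open>
  The letters of \<open>\<sigma>(i)\<close> trace a lattice path from $M x$ to $M (x + \vec e_i)$, along which the
  contributions to the dual map telescope.
\<close>

lemma dual_map_stepped_of:
  "dual_map \<sigma> (stepped_of A) = stepped_of {x. incidence_matrix \<sigma> *v x \<in> A}"
proof (rule ext, clarify)
  fix x :: "int^'a" and i
  define w where "w = \<sigma> [(i, False)]"
  define y where "y = incidence_matrix \<sigma> *v x"
  define F where "F = (\<lambda>n. case w ! n of
         (j, False) \<Rightarrow> stepped_of A (y + abelianize (take n w), j)
       | (j, True) \<Rightarrow> - stepped_of A (y + abelianize (take n w) - axis j 1, j))"
  have "(\<Sum>n<m. F n) = of_bool (y \<in> A) - of_bool (y + abelianize (take m w) \<in> A)"
    if "m \<le> length w" for m
    using that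
  proof (induction m)
    case (Suc m)
    obtain j b where jb: "w ! m = (j, b)" by (cases "w ! m")
    have "axis j (- 1) = - axis j (1::int)" by (simp add: vec_eq_iff axis_def)
    then have "y + abelianize (take (Suc m) w) =
        (if b then y + abelianize (take m w) - axis j 1 else y + abelianize (take m w) + axis j 1)"
      using Suc.prems jb by (simp add: take_Suc_conv_app_nth)
    then have "F m = of_bool (y + abelianize (take m w) \<in> A) -
        of_bool (y + abelianize (take (Suc m) w) \<in> A)"
      by (simp only:, cases b) (simp_all add: F_def stepped_of_def jb)
    then show ?case using Suc by simp
  qed simp
  from this[of "length w"] have
    "(\<Sum>n<length w. F n) = of_bool (y \<in> A) - of_bool (y + abelianize w \<in> A)"
    by simp
  moreover have "y + abelianize w = incidence_matrix \<sigma> *v (x + axis i 1)"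
    by (simp add: y_def w_def matrix_vector_right_distrib incidence_matrix_mult_axis)
  ultimately show "dual_map \<sigma> (stepped_of A) (x, i) =
      stepped_of {x. incidence_matrix \<sigma> *v x \<in> A} (x, i)"
    by (simp add: dual_map_def stepped_of_def Let_def F_def y_def w_def)
qed

lemma reduced_replicate_append: "k \<noteq> l \<Longrightarrow> reduced (replicate a (k, b) @ [(l, c)])"
proof (induction a)
  case (Suc a)
  then show ?case by (cases a) (auto simp: letter_inv_def)
qed simp

lemma incidence_brun_subst:
  assumes "i \<noteq> j"
  shows "incidence_matrix (brun_subst a i j) = brun_matrix a i j"
proof -
  have "brun_subst a i j [(l, False)] = (if l = i then replicate a (i, False) @ [(j, False)]
     else if l = j then [(i, False)] else [(l, False)])" for l
    unfolding brun_subst_def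
    using reduced_replicate_append[OF assms] by (subst free_extend_generator) auto
  then show ?thesis
    using assms by (auto simp: incidence_matrix_def brun_matrix_def vec_eq_iff axis_def)
qed

lemma incidence_brun_subst_inv_mult_axis:
  assumes "i \<noteq> j"
  shows "incidence_matrix (brun_subst_inv a i j) *v axis l 1 =
    (if l = i then axis j 1 else if l = j then axis i 1 - axis j (int a) else axis l 1)"
proof -
  have "brun_subst_inv a i j [(l, False)] = (if l = i then [(j, False)]
     else if l = j then replicate a (j, True) @ [(i, False)] else [(l, False)])"
    unfolding brun_subst_inv_def
    using reduced_replicate_append[of j i] assms by (subst free_extend_generator) auto
  moreover have "axis j (- int a) = - axis j (int a)" by (simp add: vec_eq_iff axis_def)
  ultimately show ?thesis by (simp add: incidence_matrix_mult_axis)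
qed

text \<open>Stated over a commutative ring so that one computation serves both the integer matrix
  and its real counterpart.\<close>

lemma sum_brun_matrix_row:
  fixes f :: "'d::finite \<Rightarrow> 'a::comm_ring_1"
  assumes "i \<noteq> j"
  shows "(\<Sum>l\<in>UNIV. of_int (brun_matrix a i j $ k $ l) * f l) =
    (if k = i then of_nat a * f i + f j else if k = j then f i else f k)"
proof -
  have "(\<Sum>l\<in>UNIV. of_int (brun_matrix a i j $ k $ l) * f l) =
    (\<Sum>l\<in>UNIV. (if k = i \<and> l = i then of_nat a * f i else 0) + (if k = i \<and> l = j then f j else 0) +
      (if k = j \<and> l = i then f i else 0) + (if k \<noteq> i \<and> k \<noteq> j \<and> l = k then f k else 0))"
    using assms by (intro sum.cong) (auto simp: brun_matrix_def)
  also have "\<dots> = (if k = i then of_nat a * f i + f j else if k = j then f i else f k)"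
    using assms by (auto simp: sum.distrib)
  finally show ?thesis .
qed

lemma brun_matrix_mult_nth:
  assumes "i \<noteq> j"
  shows "(brun_matrix a i j *v x) $ k =
    (if k = i then int a * x $ i + x $ j else if k = j then x $ i else x $ k)"
  using sum_brun_matrix_row[OF assms, of a k "($) x"] by (simp add: matrix_vector_mult_def)

lemma rmat_brun_matrix_mult_nth:
  assumes "i \<noteq> j"
  shows "(rmat (brun_matrix a i j) *v x) $ k =
    (if k = i then real a * x $ i + x $ j else if k = j then x $ i else x $ k)"
  using sum_brun_matrix_row[OF assms, of a k "($) x"] by (simp add: matrix_vector_mult_def rmat_def)

text \<open>Checked on basis vectors. It lets membership in the successive preimages be followed
  along the orbit of a point under Brun matrices.\<close>

lemma incidence_brun_subst_inv_mult_brun_matrix: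
  assumes "i \<noteq> j"
  shows "incidence_matrix (brun_subst_inv a i j) *v (brun_matrix a i j *v x) = x"
proof -
  let ?M = "incidence_matrix (brun_subst_inv a i j)"
  have "?M ** brun_matrix a i j = mat 1"
  proof -
    have scale: "?M *v axis l c = c *s (?M *v axis l 1)" for l c
      by (simp add: matrix_mult_axis)
    have "?M *v (brun_matrix a i j *v axis l 1) = axis l 1" for l
    proof -
      have "brun_matrix a i j *v axis l 1 =
          (if l = i then axis i (int a) + axis j 1 else if l = j then axis i 1 else axis l 1)"
        using assms by (auto simp: vec_eq_iff brun_matrix_mult_nth axis_def)
      moreover have "int a *s axis j 1 = axis j (int a)" by (simp add: vec_eq_iff axis_def)
      ultimately show ?thesis
        using assms by (auto simp: matrix_vector_right_distrib scale[of i "int a"]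
            incidence_brun_subst_inv_mult_axis)
    qed
    then have "column l (?M ** brun_matrix a i j) = column l (mat 1)" for l
      by (simp add: matrix_mult_axis[of _ _ 1, simplified, symmetric] flip: matrix_vector_mul_assoc)
    then show ?thesis by (simp add: vec_eq_iff column_def)
  qed
  then show ?thesis by (simp add: matrix_vector_mul_assoc)
qed

section \<open>Runs\<close>

text \<open>Distinct \<open>k\<close> give distinct faces, so at most one term of the family sum is
  non-zero.\<close>

lemma segment_apply:
  "segment z j i I (y, l) = of_bool (l = i \<and> (\<exists>k\<in>I. y = z + k *s axis j 1))"
proof -
  let ?F = "\<lambda>k. face (z + k *s axis j 1) i (y, l)"
  show ?thesis
  proof (cases "l = i \<and> (\<exists>k\<in>I. y = z + k *s axis j 1)")
    case True
    then obtain k where k: "k \<in> I" "y = z + k *s axis j 1" by blast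
    have "k' = k" if "k' *s axis j 1 = k *s axis j (1::int)" for k'
      using arg_cong[OF that, of "\<lambda>v. v $ j"] by simp
    then have "{k\<in>I. ?F k \<noteq> 0} = {k}"
      using True k by (auto simp: face_def)
    then show ?thesis using True k by (simp add: segment_def family_sum_def face_def)
  next
    case False
    then have "{k\<in>I. ?F k \<noteq> 0} = {}" by (auto simp: face_def)
    then show ?thesis using False unfolding segment_def family_sum_def by simp
  qed
qed

lemma segment_le_stepped_of:
  fixes A :: "(int^'d::finite) set"
  assumes "down_closed A"
  shows "segment z j i I \<le> stepped_of A \<longleftrightarrow>
    (\<forall>k\<in>I. z + k *s axis j 1 \<in> A \<and> z + k *s axis j 1 + axis i 1 \<notin> A)"
proof -
  have "x \<in> A" if "x + axis l 1 \<in> A" for x l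
    using down_closedD[OF assms that] by (simp add: axis_def)
  then have nonneg: "0 \<le> stepped_of A (x, l)" for x l
    by (auto simp: stepped_of_def)
  have one: "1 \<le> stepped_of A (x, l) \<longleftrightarrow> x \<in> A \<and> x + axis l 1 \<notin> A" for x l
    by (auto simp: stepped_of_def)
  show ?thesis
  proof (intro iffI ballI le_funI)
    fix k assume le: "segment z j i I \<le> stepped_of A" and "k \<in> I"
    then have "segment z j i I (z + k *s axis j 1, i) = 1" by (auto simp: segment_apply)
    then show "z + k *s axis j 1 \<in> A \<and> z + k *s axis j 1 + axis i 1 \<notin> A"
      using le_funD[OF le, of "(z + k *s axis j 1, i)"] one by simp
  next
    fix f :: "(int^'d) \<times> 'd" assume R: "\<forall>k\<in>I. z + k *s axis j 1 \<in> A \<and> z + k *s axis j 1 + axis i 1 \<notin> A"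
    obtain y l where f: "f = (y, l)" by (cases f)
    show "segment z j i I f \<le> stepped_of A f"
    proof (cases "l = i \<and> (\<exists>k\<in>I. y = z + k *s axis j 1)")
      case True
      then show ?thesis using R one[of y i] by (auto simp: f segment_apply)
    next
      case False
      then show ?thesis using nonneg by (auto simp: f segment_apply)
    qed
  qed
qed

text \<open>By down-closedness, the first condition on \<open>k\<close> passes to smaller
  \<open>k\<close> and the second to larger \<open>k\<close>. The set of all \<open>k\<close>
  meeting both is therefore an interval, and it is maximal because every face of a segment below the
  surface must meet both.\<close>

lemma is_run_stepped_of:
  assumes A: "down_closed A" and z: "z \<in> A" "z + axis i 1 \<notin> A"
    and I: "I = {k. z + k *s axis j 1 \<in> A \<and> z + k *s axis j 1 + axis i 1 \<notin> A}"
  shows "is_run (stepped_of A) j i (segment z j i I) (if finite I then enat (card I) else \<infinity>)"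
proof -
  have "0 \<in> I" using z by (simp add: I)
  then have "segment z j i I (z, i) = 1" by (force simp: segment_apply)
  then have "segment z j i I \<noteq> 0" by auto
  moreover have "binary (segment z j i I)"
    unfolding binary_def by (auto simp: segment_apply)
  moreover have "int_interval I"
    unfolding int_interval_def
  proof (intro ballI allI impI)
    fix a b c assume ab: "a \<in> I" "b \<in> I" and c: "a \<le> c \<and> c \<le> b"
    have "z + c *s axis j 1 \<in> A"
      by (rule down_closedD[OF A, of "z + b *s axis j 1"]) (use ab c in \<open>auto simp: I axis_def\<close>)
    moreover have "z + a *s axis j 1 + axis i 1 \<in> A" if "z + c *s axis j 1 + axis i 1 \<in> A"
      by (rule down_closedD[OF A that]) (use c in \<open>auto simp: axis_def\<close>)
    ultimately show "c \<in> I" using ab by (auto simp: I)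
  qed
  moreover have "segment z j i I \<le> stepped_of A"
    using segment_le_stepped_of[OF A] by (auto simp: I)
  moreover have "J = I" if "segment z j i J \<le> stepped_of A" "I \<subseteq> J" for J
    using that segment_le_stepped_of[OF A] by (auto simp: I)
  ultimately show ?thesis unfolding is_run_def by blast
qed

text \<open>If \<open>x\<close> were in \<open>A\<close> but x + e_k - e_i were not, the faces of
  type \<open>k\<close> at x - e_i and at \<open>x\<close> would be consecutive in one run.\<close>

lemma recession_if_runs_unit:
  assumes A: "down_closed A" and runs: "\<And>\<R> n. is_run (stepped_of A) i k \<R> n \<Longrightarrow> n = 1"
  shows "axis k 1 - axis i 1 \<in> recession A"
  unfolding recession_def
proof (intro CollectI ballI)
  fix x assume x: "x \<in> A"
  show "x + (axis k 1 - axis i 1) \<in> A"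
  proof (rule ccontr)
    assume neg: "\<not> ?thesis"
    define z where "z = x - axis i 1"
    define I where "I = {l. z + l *s axis i 1 \<in> A \<and> z + l *s axis i 1 + axis k 1 \<notin> A}"
    have z: "z \<in> A" by (rule down_closedD[OF A x]) (simp add: z_def axis_def)
    have zk: "z + axis k 1 \<notin> A" using neg by (simp add: z_def algebra_simps)
    have "x + axis k 1 \<notin> A"
    proof
      assume "x + axis k 1 \<in> A"
      then have "z + axis k 1 \<in> A" by (rule down_closedD[OF A]) (simp add: z_def axis_def)
      then show False using zk by simp
    qed
    then have "0 \<in> I" "1 \<in> I" using x z zk by (simp_all add: I_def z_def)
    moreover have "(if finite I then enat (card I) else \<infinity>) = 1"
      by (rule runs[OF is_run_stepped_of[OF A z zk I_def]])
    then have "card I = 1" by (auto simp: one_enat_def split: if_splits)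
    ultimately show False by (metis card_1_singletonE singletonD zero_neq_one)
  qed
qed

text \<open>Suppose the translate of some \<open>x\<close> in \<open>A\<close> leaves
  \<open>A\<close>. Going from \<open>x\<close> in direction e_j to the first point outside
  \<open>A\<close>, and then back by e_i, gives the first face of a run that must end before x + a
  e_j - e_i, so that it is shorter than \<open>a\<close>.\<close>

lemma recession_if_runs_ge:
  assumes A: "down_closed A" and rec: "axis j 1 - axis i 1 \<in> recession A"
    and runs: "\<And>\<R> n. is_run (stepped_of A) j i \<R> (enat n) \<Longrightarrow> a \<le> n"
  shows "axis j (int a) - axis i 1 \<in> recession A"
  unfolding recession_def
proof (intro CollectI ballI)
  fix x assume x: "x \<in> A"
  show "x + (axis j (int a) - axis i 1) \<in> A"
  proof (rule ccontr)
    assume neg: "\<not> ?thesis"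
    have below: "c < int a" if "x + c *s axis j 1 - axis i 1 \<in> A" for c
    proof (rule ccontr)
      assume "\<not> c < int a"
      then have "x + (axis j (int a) - axis i 1) \<in> A"
        by (intro down_closedD[OF A that]) (auto simp: axis_def)
      then show False using neg by simp
    qed
    define Q where "Q = {c. 0 \<le> c \<and> x + c *s axis j 1 \<in> A}"
    have "c < int a" if "c \<in> Q" for c
    proof (rule below, rule down_closedD[OF A, of "x + c *s axis j 1"])
      show "x + c *s axis j 1 \<in> A" using that by (simp add: Q_def)
    qed (simp add: axis_def)
    then have "Q \<subseteq> {0..<int a}" by (auto simp: Q_def)
    then have fin: "finite Q" by (rule finite_subset) simp
    have "0 \<in> Q" using x by (simp add: Q_def)
    define q where "q = Max Q"
    have "q \<in> Q" using fin \<open>0 \<in> Q\<close> unfolding q_def by (intro Max_in) auto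
    then have q: "0 \<le> q" "x + q *s axis j 1 \<in> A" by (simp_all add: Q_def)
    have q1: "x + (q + 1) *s axis j 1 \<notin> A"
    proof
      assume "x + (q + 1) *s axis j 1 \<in> A"
      then have "q + 1 \<in> Q" using q by (simp add: Q_def)
      then have "q + 1 \<le> q" unfolding q_def using fin by (intro Max_ge)
      then show False by simp
    qed
    define z where "z = x + (q + 1) *s axis j 1 - axis i 1"
    have z: "z \<in> A"
      using recessionD[OF rec q(2)] by (simp add: z_def algebra_simps vector_sadd_rdistrib)
    have zi: "z + axis i 1 \<notin> A" using q1 by (simp add: z_def)
    define I where "I = {k. z + k *s axis j 1 \<in> A \<and> z + k *s axis j 1 + axis i 1 \<notin> A}"
    \<comment> \<open>For negative \<open>k\<close> the point z + k e_j + e_i is at or below x + q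
      e_j, hence in \<open>A\<close>; \<open>below\<close> limits \<open>k\<close> from
      above.\<close>
    have "I \<subseteq> {0..<int a - q - 1}"
    proof
      fix k assume k: "k \<in> I"
      have "0 \<le> k"
      proof (rule ccontr)
        assume "\<not> 0 \<le> k"
        then have "z + k *s axis j 1 + axis i 1 \<in> A"
          by (intro down_closedD[OF A q(2)]) (auto simp: z_def axis_def)
        then show False using k by (simp add: I_def)
      qed
      moreover have "q + 1 + k < int a"
      proof (rule below)
        have "x + (q + 1 + k) *s axis j 1 - axis i 1 = z + k *s axis j 1"
          by (simp add: z_def vector_sadd_rdistrib)
        moreover have "z + k *s axis j 1 \<in> A" using k by (simp add: I_def)
        ultimately show "x + (q + 1 + k) *s axis j 1 - axis i 1 \<in> A" by (simp only:)
      qed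
      ultimately show "k \<in> {0..<int a - q - 1}" by simp
    qed
    then have "finite I" "card I \<le> card {0..<int a - q - 1}"
      by (auto intro: finite_subset simp del: card_atLeastLessThan_int intro!: card_mono)
    moreover have "0 \<in> I" using z zi by (simp add: I_def)
    then have "0 < card I" using \<open>finite I\<close> by (auto simp: card_gt_0_iff)
    ultimately have "card I < a" using q(1) by simp
    moreover have "a \<le> card I"
      using is_run_stepped_of[OF A z zi I_def] \<open>finite I\<close> by (intro runs) simp
    ultimately show False by simp
  qed
qed

text \<open>The run conditions become recession vectors of \<open>A\<close>. Together with the
  vectors -e_k they contain the negatives of all columns of the incidence matrix, which makes the
  preimage \<open>A'\<close> down-closed. The vectors e_k - e_j are exported for the final
  contradiction.\<close>

lemma brun_choice_stepped_of:
  assumes A: "down_closed A" and choice: "brun_choice (stepped_of A) = Some (a, i, j)"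
  defines "A' \<equiv> {x. incidence_matrix (brun_subst_inv a i j) *v x \<in> A}"
  shows "i \<noteq> j"
    and "\<And>k. k \<noteq> i \<Longrightarrow> k \<noteq> j \<Longrightarrow> axis k 1 - axis j 1 \<in> recession A"
    and "brun_surf_T (stepped_of A) = stepped_of A'"
    and "down_closed A'"
proof -
  obtain i' j' where "brun_surf_pair (stepped_of A) i' j'"
    and ij: "lex_least (brun_surf_pair (stepped_of A)) = (i, j)"
    and a: "a = (LEAST a. \<exists>\<R>. is_run (stepped_of A) j i \<R> (enat a))"
    using choice unfolding brun_choice_def by (auto split: if_splits prod.splits)
  then have pair: "brun_surf_pair (stepped_of A) i j" using lex_least(1) by blast
  then show ij: "i \<noteq> j" by (simp add: brun_surf_pair_def)
  have i_rec: "axis k 1 - axis i 1 \<in> recession A" if "k \<noteq> i" for k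
    using pair that unfolding brun_surf_pair_def by (intro recession_if_runs_unit[OF A]) blast
  show "axis k 1 - axis j 1 \<in> recession A" if "k \<noteq> i" "k \<noteq> j" for k
    using pair that unfolding brun_surf_pair_def by (intro recession_if_runs_unit[OF A]) blast
  have a_rec: "axis j (int a) - axis i 1 \<in> recession A"
    using i_rec[of j] ij unfolding a by (intro recession_if_runs_ge[OF A] Least_le) auto
  show "brun_surf_T (stepped_of A) = stepped_of A'"
    by (simp add: brun_surf_T_def choice dual_map_stepped_of A'_def)
  let ?M = "incidence_matrix (brun_subst_inv a i j)"
  have "?M *v x + - (?M *v axis k 1) \<in> A" if "?M *v x \<in> A" for x k
    by (rule recessionD[OF _ that])
      (use A a_rec in \<open>auto simp: incidence_brun_subst_inv_mult_axis[OF ij] down_closed_def\<close>)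
  then show "down_closed A'"
    by (simp add: down_closed_def recession_def A'_def
        matrix_vector_mult_diff_distrib)
qed

section \<open>Weak convergence of the Brun algorithm\<close>

text \<open>
  The Brun map restricted to the support \<open>P\<close> of the vector, once no entry vanishes any more. Then
  there are no ties either, so the largest entry always has the same index \<open>I\<close>, and only the
  index \<open>j n\<close> of the second largest entry varies.
\<close>

locale fixed_top_brun =
  fixes I :: 'd and P :: "'d set" and a :: "nat \<Rightarrow> nat" and j :: "nat \<Rightarrow> 'd"
    and \<alpha> :: "nat \<Rightarrow> 'd \<Rightarrow> real"
  assumes finite_P: "finite P" and I_in: "I \<in> P"
    and j_in: "j n \<in> P" and j_neq: "j n \<noteq> I" and a_pos: "1 \<le> a n"
    and \<alpha>_pos: "k \<in> P \<Longrightarrow> 0 < \<alpha> n k"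
    and \<alpha>_le: "k \<in> P \<Longrightarrow> k \<noteq> I \<Longrightarrow> \<alpha> n k \<le> \<alpha> n (j n)"
    and \<alpha>_Suc: "\<alpha> (Suc n) k = (if k = I then \<alpha> n (j n)
      else if k = j n then \<alpha> n I - real (a n) * \<alpha> n (j n) else \<alpha> n k)"
begin

text \<open>Orbits of the Brun matrices, whereas \<alpha> moves by their inverses. These matrices
  are symmetric, so the pairing of the two is constant.\<close>

definition dual_orbit :: "(nat \<Rightarrow> 'd \<Rightarrow> real) \<Rightarrow> bool" where
  "dual_orbit u \<longleftrightarrow> (\<forall>n k. u (Suc n) k =
     (if k = I then real (a n) * u n I + u n (j n) else if k = j n then u n I else u n k))"

lemma dual_orbit_Suc:
  "dual_orbit u \<Longrightarrow> u (Suc n) k =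
     (if k = I then real (a n) * u n I + u n (j n) else if k = j n then u n I else u n k)"
  unfolding dual_orbit_def by blast

lemma sum_P_split:
  fixes f :: "'d \<Rightarrow> real"
  shows "sum f P = f I + f (j n) + sum f (P - {I, j n})"
proof -
  have "P = insert I (insert (j n) (P - {I, j n}))" using I_in j_in by auto
  then have "sum f P = sum f (insert I (insert (j n) (P - {I, j n})))" by (rule arg_cong)
  also have "\<dots> = f I + f (j n) + sum f (P - {I, j n})"
    using finite_P j_neq[of n] by (subst sum.insert; auto)+
  finally show ?thesis .
qed

lemma dual_orbit_pairing:
  assumes "dual_orbit u"
  shows "(\<Sum>k\<in>P. \<alpha> n k * u n k) = (\<Sum>k\<in>P. \<alpha> 0 k * u 0 k)"
proof (induction n)
  case (Suc n)
  have "(\<Sum>k\<in>P - {I, j n}. \<alpha> (Suc n) k * u (Suc n) k) = (\<Sum>k\<in>P - {I, j n}. \<alpha> n k * u n k)"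
    by (intro sum.cong) (auto simp: \<alpha>_Suc dual_orbit_Suc[OF assms])
  then have "(\<Sum>k\<in>P. \<alpha> (Suc n) k * u (Suc n) k) = (\<Sum>k\<in>P. \<alpha> n k * u n k)"
    unfolding sum_P_split[of _ n] using j_neq[of n]
    by (simp add: \<alpha>_Suc dual_orbit_Suc[OF assms] algebra_simps)
  then show ?case using Suc by simp
qed simp

section \<open>Renewal of coordinates\<close>

lemma second_infinitely_often:
  assumes "k \<in> P" "k \<noteq> I"
  shows "\<exists>m\<ge>n. j m = k"
proof (rule ccontr)
  assume "\<not> ?thesis"
  then have never: "j m \<noteq> k" if "n \<le> m" for m using that by blast
  have const: "\<alpha> (n + l) k = \<alpha> n k" for l
  proof (induction l)
    case (Suc l)
    then show ?case using never[of "n + l"] assms(2) by (auto simp: \<alpha>_Suc)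
  qed simp
  \<comment> \<open>As long as \<open>k\<close> is not second, its entry is fixed, and each step
    removes at least that much from the total because the second entry is no smaller. The total
    would become negative.\<close>
  have dec: "sum (\<alpha> (n + l)) P \<le> sum (\<alpha> n) P - real l * \<alpha> n k" for l
  proof (induction l)
    case (Suc l)
    let ?m = "n + l"
    have "sum (\<alpha> (Suc ?m)) (P - {I, j ?m}) = sum (\<alpha> ?m) (P - {I, j ?m})"
      by (intro sum.cong) (auto simp: \<alpha>_Suc)
    then have "sum (\<alpha> (Suc ?m)) P = sum (\<alpha> ?m) P - real (a ?m) * \<alpha> ?m (j ?m)"
      unfolding sum_P_split[of _ ?m] using j_neq[of ?m] by (simp add: \<alpha>_Suc)
    moreover have "\<alpha> n k \<le> real (a ?m) * \<alpha> ?m (j ?m)"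
    proof -
      have "\<alpha> n k \<le> 1 * \<alpha> ?m (j ?m)" using \<alpha>_le[OF assms, of ?m] const by simp
      also have "\<dots> \<le> real (a ?m) * \<alpha> ?m (j ?m)"
        using a_pos[of ?m] \<alpha>_pos[OF j_in] by (intro mult_right_mono) (auto intro: less_imp_le)
      finally show ?thesis .
    qed
    ultimately show ?case using Suc by (simp add: algebra_simps)
  qed simp
  obtain l where "sum (\<alpha> n) P < real l * \<alpha> n k"
    using reals_Archimedean3[OF \<alpha>_pos[OF assms(1)]] by blast
  then have "sum (\<alpha> (n + l)) P < 0" using dec[of l] by simp
  moreover have "0 \<le> sum (\<alpha> (n + l)) P" using \<alpha>_pos by (intro sum_nonneg) (auto intro: less_imp_le)
  ultimately show False by simp
qed

text \<open>A coordinate takes over the previous top entry when its index is second; these are the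
  coordinates whose entry in any dual orbit still dates from time \<open>n0\<close>.\<close>

definition stale :: "nat \<Rightarrow> nat \<Rightarrow> 'd set" where
  "stale n0 n = P - {I} - j ` {n0..<n}"

lemma stale_Suc: "n0 \<le> n \<Longrightarrow> stale n0 (Suc n) = stale n0 n - {j n}"
  by (auto simp: stale_def atLeastLessThanSuc)

lemma eventually_not_stale: "\<exists>n\<ge>n0. stale n0 n = {}"
proof -
  have "\<forall>k\<in>P - {I}. \<exists>m. n0 \<le> m \<and> j m = k" using second_infinitely_often by blast
  then obtain m where m: "\<And>k. k \<in> P - {I} \<Longrightarrow> n0 \<le> m k \<and> j (m k) = k" by metis
  define n where "n = Suc (n0 + sum m (P - {I}))"
  have "m k < n" if "k \<in> P - {I}" for k
    using member_le_sum[of k "P - {I}" m] that finite_P by (simp add: n_def)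
  then have "P - {I} \<subseteq> j ` {n0..<n}" using m by force
  then show ?thesis by (intro exI[of _ n]) (auto simp: stale_def n_def)
qed

text \<open>A renewed coordinate keeps the top entry it received until it is renewed again. The time
  \<open>m\<close> depends only on the indices and not on \<open>u\<close>, so two dual orbits can
  be compared at the same \<open>m\<close>.\<close>

lemma not_stale_value:
  assumes "n0 \<le> n" "k \<in> P" "k \<notin> stale n0 n"
  shows "\<exists>m\<ge>n0. \<forall>u. dual_orbit u \<longrightarrow> u n k = u m I"
  using assms
proof (induction n arbitrary: k rule: dec_induct)
  case base
  then show ?case by (auto simp: stale_def)
next
  case (step n)
  consider "k = I" | "k \<noteq> I" "k = j n" | "k \<noteq> I" "k \<noteq> j n" by blast
  then show ?case
  proof cases
    case 1
    then show ?thesis using step.hyps by (intro exI[of _ "Suc n"]) auto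
  next
    case 2
    then show ?thesis using step.hyps by (intro exI[of _ n]) (auto simp: dual_orbit_Suc)
  next
    case 3
    then have "k \<notin> stale n0 n" using step.prems step.hyps by (simp add: stale_Suc)
    then obtain m where "m \<ge> n0" "\<forall>u. dual_orbit u \<longrightarrow> u n k = u m I"
      using step.IH step.prems(1) by blast
    then show ?thesis using 3 by (intro exI[of _ m]) (auto simp: dual_orbit_Suc)
  qed
qed

lemma eventually_renewed:
  "\<exists>n\<ge>n0. \<forall>k\<in>P. \<exists>m\<ge>n0. \<forall>u. dual_orbit u \<longrightarrow> u n k = u m I"
  using eventually_not_stale[of n0] not_stale_value[of n0] by blast

text \<open>The dual orbit of the all-ones vector, used as a yardstick: its entries stay at least 1,
  and the top one is the largest and grows without bound.\<close>

primrec weight :: "nat \<Rightarrow> 'd \<Rightarrow> real" where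
  "weight 0 = (\<lambda>_. 1)"
| "weight (Suc n) = (\<lambda>k. if k = I then real (a n) * weight n I + weight n (j n)
     else if k = j n then weight n I else weight n k)"

lemma dual_orbit_weight: "dual_orbit weight"
  by (simp add: dual_orbit_def)

lemma dual_orbit_diff: "dual_orbit u \<Longrightarrow> dual_orbit (\<lambda>n k. u n k - l * weight n k)"
  by (auto simp: dual_orbit_def algebra_simps)

lemma real_a: "1 \<le> real (a n)"
  using a_pos[of n] by simp

lemma weight_ge_1: "1 \<le> weight n k"
proof (induction n arbitrary: k)
  case (Suc n)
  have "0 \<le> real (a n) * weight n I" using Suc[of I] by simp
  then have "1 \<le> real (a n) * weight n I + weight n (j n)" using Suc[of "j n"] by linarith
  then show ?case using Suc by simp
qed simp

lemma weight_top_le: "weight n I \<le> real (a n) * weight n I"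
  using mult_right_mono[of 1 "real (a n)" "weight n I"] real_a[of n] weight_ge_1[of n I]
  by linarith

lemma weight_top_Suc: "weight n I + weight n (j n) \<le> weight (Suc n) I"
  using weight_top_le[of n] by simp

lemma weight_le_top: "weight n k \<le> weight n I"
proof (induction n arbitrary: k)
  case (Suc n)
  have "weight (Suc n) k = weight (Suc n) I \<or> weight (Suc n) k = weight n I \<or>
      weight (Suc n) k = weight n k"
    by (cases "k = I") auto
  then show ?case
    using weight_top_Suc[of n] weight_ge_1[of n "j n"] Suc[of k] by (elim disjE) linarith+
qed simp

lemma weight_top_ge: "real n + 1 \<le> weight n I"
proof (induction n)
  case (Suc n)
  then show ?case using weight_top_Suc[of n] weight_ge_1[of n "j n"] by linarith
qed simp

lemma dual_orbit_nonneg: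
  assumes u: "dual_orbit u" and nn: "\<And>k. k \<in> P \<Longrightarrow> 0 \<le> u n0 k" and "n0 \<le> n" "k \<in> P"
  shows "0 \<le> u n k"
  using assms(3,4)
proof (induction n arbitrary: k rule: dec_induct)
  case (step n)
  then show ?case using I_in j_in by (simp add: dual_orbit_Suc[OF u])
qed (rule nn)

text \<open>
  Each renewal of a stale coordinate at most halves the bound, because \<open>weight n (j n)\<close> does
  not exceed \<open>weight n I\<close>; all other steps preserve it.
\<close>

lemma dual_orbit_spread:
  assumes u: "dual_orbit u" and nn: "\<And>k. k \<in> P \<Longrightarrow> 0 \<le> u n0 k"
    and top: "c * weight n0 I \<le> u n0 I" and c: "0 \<le> c"
    and "n0 \<le> n" "k \<in> P" "k \<notin> stale n0 n"
  shows "c * 2 ^ card (stale n0 n) / 2 ^ card (P - {I}) * weight n k \<le> u n k"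
  using assms(5-7)
proof (induction n arbitrary: k rule: dec_induct)
  case base
  then show ?case using top by (auto simp: stale_def)
next
  case (step n)
  define q where "q = (\<lambda>n. c * 2 ^ card (stale n0 n) / 2 ^ card (P - {I}))"
  have q_nn: "0 \<le> q n" for n using c by (simp add: q_def)
  have fin: "finite (stale n0 n)" using finite_P by (simp add: stale_def)
  have I_fresh: "I \<notin> stale n0 n" by (simp add: stale_def)
  have IH: "q n * weight n k \<le> u n k" if "k \<in> P" "k \<notin> stale n0 n" for k
    using step.IH that unfolding q_def by blast
  have q_le: "q (Suc n) \<le> q n"
  proof -
    have "card (stale n0 (Suc n)) \<le> card (stale n0 n)"
      using fin step.hyps by (intro card_mono) (auto simp: stale_Suc)
    then show ?thesis unfolding q_def using c
      by (intro divide_right_mono mult_left_mono power_increasing) auto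
  qed
  have mono: "q (Suc n) * weight n l \<le> q n * weight n l" for l
    using q_le weight_ge_1[of n l] by (intro mult_right_mono) auto
  have "q (Suc n) * weight (Suc n) k \<le> u (Suc n) k"
  proof (cases "k = I")
    case False
    show ?thesis
    proof (cases "k = j n")
      case True
      then show ?thesis
        using False mono[of I] IH[OF I_in I_fresh] by (simp add: dual_orbit_Suc[OF u])
    next
      case F: False
      then have "k \<notin> stale n0 n" using step by (simp add: stale_Suc)
      then show ?thesis
        using F False mono[of k] IH step.prems by (fastforce simp: dual_orbit_Suc[OF u])
    qed
  next
    case True
    have ge: "q n * (real (a n) * weight n I) \<le> real (a n) * u n I"
      using mult_left_mono[OF IH[OF I_in I_fresh], of "real (a n)"] by (simp add: algebra_simps)
    show ?thesis
    proof (cases "j n \<in> stale n0 n")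
      case stale: True
      have "card (stale n0 n) = Suc (card (stale n0 (Suc n)))"
        unfolding stale_Suc[OF step.hyps(1)] by (rule card_Suc_Diff1[OF fin stale, symmetric])
      then have half: "q n = 2 * q (Suc n)" by (simp add: q_def)
      have "weight n (j n) \<le> real (a n) * weight n I"
        using weight_le_top[of n "j n"] weight_top_le[of n] by linarith
      then have "q (Suc n) * (real (a n) * weight n I + weight n (j n)) \<le>
          q (Suc n) * (2 * (real (a n) * weight n I))"
        using q_nn by (intro mult_left_mono) auto
      also have "\<dots> \<le> real (a n) * u n I" using ge by (simp add: half)
      also have "\<dots> \<le> real (a n) * u n I + u n (j n)"
        using dual_orbit_nonneg[OF u nn step.hyps(1) j_in] by simp
      finally show ?thesis using True by (simp add: dual_orbit_Suc[OF u])
    next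
      case False
      then have "q (Suc n) = q n" using step.hyps by (simp add: q_def stale_Suc)
      then show ?thesis
        using ge IH[OF j_in False] True by (simp add: dual_orbit_Suc[OF u] algebra_simps)
    qed
  qed
  then show ?case by (simp add: q_def)
qed

text \<open>At every time, \<open>lim\<close> is an average over \<open>P\<close> of the ratios of
  \<open>u\<close> to \<open>weight\<close>, with coefficients proportional to
  \<open>\<alpha> n k * weight n k\<close>. The lower bounds of these ratios have supremum at least
  \<open>lim\<close>, so some positive bound holds, and the growth of \<open>weight\<close> makes
  \<open>u\<close> large.\<close>

lemma dual_orbit_large:
  assumes u: "dual_orbit u" and pos: "0 < (\<Sum>k\<in>P. \<alpha> 0 k * u 0 k)"
  shows "\<exists>n. \<forall>k\<in>P. C \<le> u n k"
proof -
  define W where "W = (\<Sum>k\<in>P. \<alpha> 0 k * weight 0 k)"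
  have "0 < W" unfolding W_def using finite_P I_in \<alpha>_pos by (intro sum_pos) auto
  define lim where "lim = (\<Sum>k\<in>P. \<alpha> 0 k * u 0 k) / W"
  have "0 < lim" using pos \<open>0 < W\<close> by (simp add: lim_def)
  have diff: "(\<Sum>k\<in>P. \<alpha> n k * (u n k - l * weight n k)) = (lim - l) * W" for n l
  proof -
    have "(\<Sum>k\<in>P. \<alpha> n k * (u n k - l * weight n k)) =
        (\<Sum>k\<in>P. \<alpha> 0 k * u 0 k) - l * W"
      using dual_orbit_pairing[OF dual_orbit_diff[OF u], of n l]
      by (simp add: W_def algebra_simps sum_subtractf sum_distrib_left del: weight.simps)
    moreover have "(\<Sum>k\<in>P. \<alpha> 0 k * u 0 k) = lim * W" using \<open>0 < W\<close> by (simp add: lim_def)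
    ultimately show ?thesis by (simp only: left_diff_distrib)
  qed
  define L where "L = {l. \<exists>n. \<forall>k\<in>P. l * weight n k \<le> u n k}"
  have L_le: "l \<le> lim" if "l \<in> L" for l
  proof -
    obtain n where "\<forall>k\<in>P. l * weight n k \<le> u n k" using \<open>l \<in> L\<close> by (auto simp: L_def)
    then have "0 \<le> (\<Sum>k\<in>P. \<alpha> n k * (u n k - l * weight n k))"
      using \<alpha>_pos by (intro sum_nonneg mult_nonneg_nonneg) (auto intro: less_imp_le)
    then have "0 \<le> (lim - l) * W" by (simp only: diff)
    then show ?thesis using \<open>0 < W\<close> by (simp add: zero_le_mult_iff)
  qed
  then have bdd: "bdd_above L" by (meson bdd_aboveI)
  have ne: "L \<noteq> {}"
  proof -
    have "Min (u 0 ` P) \<in> L" using finite_P by (auto simp: L_def intro!: exI[of _ 0])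
    then show ?thesis by blast
  qed
  have "lim \<le> Sup L"
  proof (rule ccontr)
    assume "\<not> ?thesis"
    define c where "c = lim - Sup L"
    have "0 < c" using \<open>\<not> lim \<le> Sup L\<close> by (simp add: c_def)
    \<comment> \<open>The guaranteed gain: an excess \<open>c\<close> at the top loses at most a
      factor 2 for each other coordinate of \<open>P\<close> while it spreads.\<close>
    define \<eta> where "\<eta> = c / 2 ^ card (P - {I})"
    have "0 < \<eta>" using \<open>0 < c\<close> by (simp add: \<eta>_def)
    then obtain l where l: "l \<in> L" "Sup L - \<eta> < l"
      using less_cSupD[OF ne, of "Sup L - \<eta>"] by auto
    then obtain n0 where n0: "\<And>k. k \<in> P \<Longrightarrow> 0 \<le> u n0 k - l * weight n0 k"
      by (auto simp: L_def)
    define w where "w = (\<lambda>n k. u n k - l * weight n k)"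
    have w: "dual_orbit w" unfolding w_def by (rule dual_orbit_diff[OF u])
    have w_nn: "0 \<le> w n k" if "n0 \<le> n" "k \<in> P" for n k
      by (rule dual_orbit_nonneg[OF w _ that]) (use n0 in \<open>simp add: w_def\<close>)
    \<comment> \<open>If the top ratio stayed below \<open>lim\<close>, then once all coordinates
      had been renewed, every ratio would be below the average of the ratios.\<close>
    have "\<exists>n1\<ge>n0. lim * weight n1 I \<le> u n1 I"
    proof (rule ccontr)
      assume "\<not> ?thesis"
      then have lt: "u m I < lim * weight m I" if "n0 \<le> m" for m using that by force
      obtain n where n: "\<forall>k\<in>P. \<exists>m\<ge>n0. \<forall>u. dual_orbit u \<longrightarrow> u n k = u m I"
        using eventually_renewed by blast
      have "u n k < lim * weight n k" if "k \<in> P" for k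
        using n that u dual_orbit_weight lt by metis
      then have "\<alpha> n k * (u n k - lim * weight n k) < 0" if "k \<in> P" for k
        using \<alpha>_pos that by (simp add: mult_less_0_iff)
      then have "(\<Sum>k\<in>P. \<alpha> n k * (u n k - lim * weight n k)) < (\<Sum>k\<in>P. 0)"
        using finite_P I_in by (intro sum_strict_mono) auto
      then show False unfolding diff by simp
    qed
    then obtain n1 where n1: "n0 \<le> n1" "lim * weight n1 I \<le> u n1 I" by blast
    have "c * weight n1 I \<le> w n1 I"
    proof -
      have "c * weight n1 I \<le> (lim - l) * weight n1 I"
        using cSup_upper[OF l(1) bdd] weight_ge_1[of n1 I] by (intro mult_right_mono) (auto simp: c_def)
      then show ?thesis using n1(2) by (simp add: w_def algebra_simps)
    qed
    moreover obtain n2 where n2: "n1 \<le> n2" "stale n1 n2 = {}"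
      using eventually_not_stale by blast
    ultimately have "\<eta> * weight n2 k \<le> w n2 k" if "k \<in> P" for k
      using dual_orbit_spread[OF w, of n1 c n2 k] w_nn[OF n1(1)] \<open>0 < c\<close> that
      by (simp add: \<eta>_def)
    \<comment> \<open>This lower bound exceeds \<open>Sup L\<close> by the choice of
      \<open>l\<close>.\<close>
    then have "l + \<eta> \<in> L" by (force simp: L_def w_def algebra_simps)
    then show False using cSup_upper[OF _ bdd] l(2) by force
  qed
  then obtain l where l: "l \<in> L" "0 < l"
    using less_cSupD[OF ne, of 0] \<open>0 < lim\<close> by auto
  then obtain n1 where n1: "\<And>k. k \<in> P \<Longrightarrow> 0 \<le> u n1 k - l * weight n1 k"
    by (auto simp: L_def)
  \<comment> \<open>Entries renewed after time \<open>N\<close> are top entries of a time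
    \<open>m\<close> at least \<open>N\<close>, where \<open>weight\<close> is at least
    \<open>m + 1\<close>.\<close>
  obtain N where N: "C < real N * l" using reals_Archimedean3[OF l(2)] by blast
  obtain n where n: "n \<ge> max n1 N" "\<forall>k\<in>P. \<exists>m\<ge>max n1 N. \<forall>u. dual_orbit u \<longrightarrow> u n k = u m I"
    using eventually_renewed by blast
  have "C \<le> u n k" if kP: "k \<in> P" for k
  proof -
    obtain m where m: "m \<ge> max n1 N" "\<forall>u. dual_orbit u \<longrightarrow> u n k = u m I"
      using bspec[OF n(2) kP] by blast
    have "weight n k = weight m I" using m(2) dual_orbit_weight by simp
    then have "real N \<le> weight n k" using weight_top_ge[of m] m(1) by simp
    then have "real N * l \<le> weight n k * l" using l(2) by (intro mult_right_mono) auto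
    then have "C \<le> l * weight n k" using N by (simp add: mult.commute[of l])
    moreover have "l * weight n k \<le> u n k"
      using dual_orbit_nonneg[OF dual_orbit_diff[OF u] n1, of n k] kP n(1) by simp
    ultimately show ?thesis by simp
  qed
  then show ?thesis by blast
qed

end

section \<open>Quasi-planes and Brun expansions\<close>

lemma rvec_inner: "rvec x \<bullet> \<alpha> = (\<Sum>k\<in>UNIV. of_int (x $ k) * \<alpha> $ k)"
  by (simp add: inner_vec_def)

text \<open>As \<alpha> is non-negative, the half-space is down-closed and the difference of
  indicators never becomes -1.\<close>

lemma stepped_plane_eq:
  assumes "\<And>i. 0 \<le> \<alpha> $ i"
  shows "stepped_plane \<alpha> \<rho> = stepped_of {x. rvec x \<bullet> \<alpha> < \<rho>}"
proof (rule ext, clarify)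
  fix x :: "int^'a" and i
  have "rvec (x + axis i 1) = rvec x + axis i 1"
    by (simp add: vec_eq_iff axis_def)
  then have "rvec (x + axis i 1) \<bullet> \<alpha> = rvec x \<bullet> \<alpha> + \<alpha> $ i"
    by (simp add: inner_add_left inner_axis' )
  then show "stepped_plane \<alpha> \<rho> (x, i) = stepped_of {x. rvec x \<bullet> \<alpha> < \<rho>} (x, i)"
    using assms[of i] by (auto simp: stepped_plane_def stepped_of_def)
qed

text \<open>The flip at \<open>x\<close> is \<open>stepped_of {x}\<close>, and only the flips at
  \<open>y\<close> and at \<open>y + axis i 1\<close> affect the face at
  \<open>(y, i)\<close>.\<close>

lemma family_sum_flip: "family_sum D flip = stepped_of D"
proof (rule ext, clarify)
  fix y :: "int^'a" and i
  have neq: "y + axis i 1 \<noteq> y" by (simp add: vec_eq_iff axis_def)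
  have eq: "y = x - axis i 1 \<longleftrightarrow> x = y + axis i 1" for x
    by (auto simp: algebra_simps)
  have "family_sum D flip (y, i) = (\<Sum>x\<in>D \<inter> {y, y + axis i 1}. flip x (y, i))"
    unfolding family_sum_def
    by (rule sum.mono_neutral_left) (auto simp: flip_apply eq split: if_splits)
  also have "\<dots> = (\<Sum>x\<in>{y, y + axis i 1}. if x \<in> D then flip x (y, i) else 0)"
    by (subst Int_commute) (rule sum.inter_restrict, simp)
  also have "\<dots> = stepped_of D (y, i)"
    using neq neq[symmetric] by (auto simp: flip_apply eq stepped_of_def)
  finally show "family_sum D flip (y, i) = stepped_of D (y, i)" .
qed

text \<open>With \<rho> the supremum of the scalar product over \<open>A\<close>, separation puts
  every lattice point strictly below \<rho> into \<open>A\<close>. So \<open>A\<close> is the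
  disjoint union of an open half-space and the set \<open>D\<close> of its points on the hyperplane,
  where the flips take place.\<close>

lemma stepped_quasi_planeI:
  assumes S: "stepped_surface (stepped_of A)" and \<alpha>: "\<And>i. 0 \<le> \<alpha> $ i"
    and ne: "A \<noteq> {}" "A \<noteq> UNIV"
    and sep: "\<And>x y. x \<in> A \<Longrightarrow> y \<notin> A \<Longrightarrow> rvec x \<bullet> \<alpha> \<le> rvec y \<bullet> \<alpha>"
  shows "stepped_quasi_plane \<alpha> (stepped_of A)"
proof -
  define \<rho> where "\<rho> = (SUP x\<in>A. rvec x \<bullet> \<alpha>)"
  obtain y where y: "y \<notin> A" using ne by blast
  have "bdd_above ((\<lambda>x. rvec x \<bullet> \<alpha>) ` A)" by (rule bdd_aboveI2) (rule sep[OF _ y])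
  then have le: "rvec x \<bullet> \<alpha> \<le> \<rho>" if "x \<in> A" for x
    unfolding \<rho>_def using that by (intro cSUP_upper)
  have ge: "\<rho> \<le> rvec x \<bullet> \<alpha>" if "x \<notin> A" for x
    unfolding \<rho>_def using ne sep[OF _ that] by (intro cSUP_least)
  define D where "D = {x\<in>A. rvec x \<bullet> \<alpha> = \<rho>}"
  have "of_bool (x \<in> A) = of_bool (rvec x \<bullet> \<alpha> < \<rho>) + (of_bool (x \<in> D) :: int)" for x
    using le[of x] ge[of x] by (auto simp: D_def)
  then have "stepped_of A = stepped_plane \<alpha> \<rho> + family_sum D flip"
    unfolding stepped_plane_eq[OF \<alpha>] family_sum_flip
    by (auto simp: stepped_of_def fun_eq_iff)
  moreover have "D \<subseteq> {x. rvec x \<bullet> \<alpha> = \<rho>}" by (auto simp: D_def)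
  ultimately show ?thesis using S unfolding stepped_quasi_plane_def by blast
qed

section \<open>Matching the expansions of vectors and surfaces\<close>

lemma brun_matrix_inject:
  assumes "brun_matrix a i j = brun_matrix a' i' j'" "i \<noteq> j" "i' \<noteq> j'" "1 \<le> a'"
  shows "a = a' \<and> i = i' \<and> j = j'"
proof -
  have eq: "brun_matrix a i j $ k $ l = brun_matrix a' i' j' $ k $ l" for k l
    using assms(1) by simp
  \<comment> \<open>Since \<open>1 \<le> a'\<close>, the only zero on the diagonal of the second
    matrix is at \<open>j'\<close>; the only non-zero entry of its column \<open>j'\<close> is in
    row \<open>i'\<close>.\<close>
  have "j = j'" using eq[of j j] assms(2-4) by (auto simp: brun_matrix_def split: if_splits)
  moreover have "i = i'"
    using eq[of i j] assms(2-4) \<open>j = j'\<close> by (auto simp: brun_matrix_def split: if_splits)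
  ultimately show ?thesis using eq[of i i] by (simp add: brun_matrix_def)
qed

text \<open>An identity matrix in the expansion stands for a fixed surface or for the absence of a
  pair. The zero at \<open>(j, j)\<close> excludes both, and the matrix then determines the
  parameters.\<close>

lemma brun_choice_of_expansion:
  assumes "brun_surf_expansion \<S> (Suc n) = brun_matrix a i j" "i \<noteq> j" "1 \<le> a"
    and S: "(brun_surf_T ^^ n) \<S> = stepped_of A" and A: "down_closed A"
  shows "brun_choice (stepped_of A) = Some (a, i, j)"
proof -
  have "brun_matrix a i j $ j $ j \<noteq> mat 1 $ j $ j" using assms(2) by (simp add: brun_matrix_def mat_def)
  then have neq: "brun_matrix a i j \<noteq> mat 1" by metis
  obtain a' i' j' where choice: "brun_choice (stepped_of A) = Some (a', i', j')"
    and "incidence_matrix (brun_subst a' i' j') = brun_matrix a i j"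
    using assms(1) neq by (auto simp: brun_surf_expansion_def S Let_def split: if_splits option.splits)
  moreover have "i' \<noteq> j'" by (rule brun_choice_stepped_of(1)[OF A choice])
  ultimately show ?thesis
    using brun_matrix_inject assms(2,3) by (metis incidence_brun_subst)
qed

lemma rmat_brun_matrix_inner:
  assumes "i \<noteq> j"
  shows "(rmat (brun_matrix a i j) *v u) \<bullet> w = u \<bullet> (rmat (brun_matrix a i j) *v w)"
proof -
  have "transpose (rmat (brun_matrix a i j)) = rmat (brun_matrix a i j)"
  proof -
    have "brun_matrix a i j $ k $ l = brun_matrix a i j $ l $ k" for k l
      using assms unfolding brun_matrix_def
      by (cases "k = i"; cases "l = i"; cases "k = j"; cases "l = j") auto
    then show ?thesis by (simp add: transpose_def rmat_def vec_eq_iff)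
  qed
  then show ?thesis by (metis dot_lmul_matrix transpose_matrix_vector)
qed

text \<open>One step divides the largest entry by the second largest, with remainder. The facts on
  ties and the bound by \<open>\<alpha> $ j\<close> serve to show that the top index
  stabilises.\<close>

lemma brun_vec_step:
  fixes \<alpha> :: "real^'d::{finite,wellorder}"
  assumes d: "CARD('d) \<ge> 2" and \<alpha>: "\<alpha> \<in> nonneg_vecs" "\<alpha> \<notin> axis_vecs"
  obtains a i j where "i \<noteq> j" "1 \<le> a" "brun_vec_B \<alpha> = brun_matrix a i j"
    "\<And>k. \<alpha> $ k \<le> \<alpha> $ i" "\<And>k. k \<noteq> i \<Longrightarrow> \<alpha> $ k \<le> \<alpha> $ j" "0 < \<alpha> $ j"
    "\<alpha> $ i = \<alpha> $ j \<Longrightarrow> a = 1" "\<And>k. brun_vec_T \<alpha> $ k \<le> \<alpha> $ j"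
    "\<And>k. brun_vec_T \<alpha> $ k =
      (if k = i then \<alpha> $ j else if k = j then \<alpha> $ i - real a * \<alpha> $ j else \<alpha> $ k)"
    "brun_vec_T \<alpha> \<in> nonneg_vecs"
proof -
  have nonneg: "0 \<le> \<alpha> $ k" for k using \<alpha> by (simp add: nonneg_vecs_def)
  have "\<exists>i j. brun_vec_pair \<alpha> i j"
  proof -
    have "Max (range (($) \<alpha>)) \<in> range (($) \<alpha>)" by (intro Max_in) auto
    then obtain i where i: "Max (range (($) \<alpha>)) = \<alpha> $ i" by blast
    have "UNIV \<noteq> {i}"
    proof
      assume "UNIV = {i}"
      then have "CARD('d) = card {i}" by simp
      then show False using d by simp
    qed
    then have "UNIV - {i} \<noteq> {}" by blast
    then have "Max (($) \<alpha> ` (UNIV - {i})) \<in> ($) \<alpha> ` (UNIV - {i})" by (intro Max_in) auto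
    then obtain j where "Max (($) \<alpha> ` (UNIV - {i})) = \<alpha> $ j" "j \<noteq> i" by blast
    then show ?thesis using i unfolding brun_vec_pair_def by metis
  qed
  moreover obtain i j where ij: "lex_least (brun_vec_pair \<alpha>) = (i, j)" by fastforce
  ultimately have pair: "brun_vec_pair \<alpha> i j" using lex_least(1) by blast
  then have neq: "i \<noteq> j" by (simp add: brun_vec_pair_def)
  have i_max: "\<alpha> $ k \<le> \<alpha> $ i" for k using pair by (simp add: brun_vec_pair_def)
  have j_max: "\<alpha> $ k \<le> \<alpha> $ j" if "k \<noteq> i" for k
    using pair that by (simp add: brun_vec_pair_def)
  have j_pos: "0 < \<alpha> $ j"
  proof (rule ccontr)
    assume "\<not> ?thesis"
    then have "\<alpha> $ k = 0" if "k \<noteq> i" for k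
      using j_max[OF that] nonneg[of k] by simp
    then have eq: "\<alpha> = \<alpha> $ i *\<^sub>R axis i 1" by (simp add: vec_eq_iff axis_def)
    then have "\<alpha> $ i \<noteq> 0" using \<alpha>(1) unfolding nonneg_vecs_def by auto
    then have "0 < \<alpha> $ i" using nonneg[of i] by simp
    then show False using \<alpha>(2) eq unfolding axis_vecs_def by blast
  qed
  define a where "a = nat \<lfloor>\<alpha> $ i / \<alpha> $ j\<rfloor>"
  have "1 \<le> \<alpha> $ i / \<alpha> $ j" using j_pos i_max[of j] by simp
  then have a1: "1 \<le> a" unfolding a_def by linarith
  have "real a \<le> \<alpha> $ i / \<alpha> $ j"
    unfolding a_def using \<open>1 \<le> \<alpha> $ i / \<alpha> $ j\<close> by linarith
  then have a_le: "real a * \<alpha> $ j \<le> \<alpha> $ i" using j_pos by (simp add: field_simps)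
  have B: "brun_vec_B \<alpha> = brun_matrix a i j"
    using \<alpha>(2) ij by (simp add: brun_vec_B_def a_def)
  let ?R = "rmat (brun_matrix a i j)"
  \<comment> \<open>The inverse matrix is not computed: the expected image is checked to be mapped
    to \<alpha>, and injectivity of the matrix gives the rest.\<close>
  define T where "T = (\<chi> k. if k = i then \<alpha> $ j else if k = j then \<alpha> $ i - real a * \<alpha> $ j else \<alpha> $ k)"
  have RT: "?R *v T = \<alpha>"
    using neq by (simp add: vec_eq_iff rmat_brun_matrix_mult_nth T_def)
  have "brun_vec_T \<alpha> = T"
  proof -
    have "invertible ?R"
    proof -
      have "inj ((*v) ?R)"
      proof (rule injI)
        fix u w assume eq: "?R *v u = ?R *v w"
        have comp: "(?R *v u) $ k = (?R *v w) $ k" for k using eq by simp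
        have 1: "u $ i = w $ i" using comp[of j] neq by (simp add: rmat_brun_matrix_mult_nth)
        have "u $ j = w $ j" using comp[of i] 1 neq by (simp add: rmat_brun_matrix_mult_nth)
        moreover have "u $ k = w $ k" if "k \<noteq> i" "k \<noteq> j" for k
          using comp[of k] that neq by (simp add: rmat_brun_matrix_mult_nth)
        ultimately show "u = w" using 1 by (metis vec_eq_iff)
      qed
      then show ?thesis by (simp add: invertible_left_inverse matrix_left_invertible_injective)
    qed
    then have "matrix_inv ?R ** ?R = mat 1"
      unfolding invertible_def matrix_inv_def by (rule someI2_ex) blast
    then have "matrix_inv ?R *v (?R *v T) = T" by (simp add: matrix_vector_mul_assoc)
    then show ?thesis by (simp add: brun_vec_T_def B RT)
  qed
  moreover have "T \<in> nonneg_vecs"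
  proof -
    have "T $ i \<noteq> 0" using j_pos by (simp add: T_def)
    then have "T \<noteq> 0" by auto
    moreover have "0 \<le> T $ k" for k using nonneg a_le by (simp add: T_def)
    ultimately show ?thesis by (simp add: nonneg_vecs_def)
  qed
  moreover have "T $ k \<le> \<alpha> $ j" for k
  proof -
    have "\<alpha> $ i / \<alpha> $ j \<le> real a + 1"
      unfolding a_def using \<open>1 \<le> \<alpha> $ i / \<alpha> $ j\<close> by linarith
    then have "\<alpha> $ i - real a * \<alpha> $ j \<le> \<alpha> $ j" using j_pos by (simp add: field_simps)
    then show ?thesis using j_max by (simp add: T_def)
  qed
  moreover have "a = 1" if "\<alpha> $ i = \<alpha> $ j"
    using that j_pos by (simp add: a_def)
  ultimately show thesis
    using that[of i j a] neq a1 B i_max j_max j_pos by (simp add: T_def)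
qed

text \<open>The Brun matrix is symmetric and maps \<alpha>' back to \<alpha>.\<close>

lemma brun_matrix_inner_invariant:
  assumes "i \<noteq> j" "\<And>k. \<alpha>' $ k =
      (if k = i then \<alpha> $ j else if k = j then \<alpha> $ i - real a * \<alpha> $ j else \<alpha> $ k)"
  shows "rvec (brun_matrix a i j *v v) \<bullet> \<alpha>' = rvec v \<bullet> \<alpha>"
proof -
  have "rvec (brun_matrix a i j *v v) = rmat (brun_matrix a i j) *v rvec v"
    using assms(1) by (simp add: vec_eq_iff brun_matrix_mult_nth rmat_brun_matrix_mult_nth)
  moreover have "rmat (brun_matrix a i j) *v \<alpha>' = \<alpha>"
    using assms by (simp add: vec_eq_iff rmat_brun_matrix_mult_nth)
  ultimately show ?thesis by (simp add: rmat_brun_matrix_inner[OF assms(1)])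
qed

lemma eventually_constant_finite_chain:
  fixes Z :: "nat \<Rightarrow> 'a::finite set"
  assumes "\<And>n. Z n \<subseteq> Z (Suc n)"
  obtains N where "\<And>n. Z (N + n) = Z N"
proof -
  have "card (Z n) < Suc CARD('a)" for n by (simp add: less_Suc_eq_le card_mono)
  then have "\<exists>N. \<forall>n. card (Z n) \<le> card (Z N)"
    using ex_has_greatest_nat[of "\<lambda>_. True" 0 "\<lambda>n. card (Z n)" "Suc CARD('a)"] by simp
  then obtain N where N: "\<And>n. card (Z n) \<le> card (Z N)" by blast
  have "Z (N + n) = Z N" for n
  proof -
    have "Z N \<subseteq> Z (N + n)" using lift_Suc_mono_le[of Z N "N + n"] assms by simp
    then show ?thesis using N[of "N + n"] by (intro card_seteq[symmetric]) auto
  qed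
  then show thesis using that by blast
qed

lemma same_expansion_separated:
  fixes \<alpha> :: "real^'d::{finite,wellorder}"
  assumes d: "CARD('d) \<ge> 2" and \<alpha>: "\<alpha> \<in> nonneg_vecs"
    and infinite: "\<And>n. (brun_vec_T ^^ n) \<alpha> \<notin> axis_vecs"
    and S: "stepped_of A \<in> same_expansion_surfaces \<alpha>" and A: "down_closed A"
    and x: "x \<in> A" and y: "y \<notin> A"
  shows "rvec x \<bullet> \<alpha> \<le> rvec y \<bullet> \<alpha>"
proof (rule ccontr)
  assume "\<not> ?thesis"
  then have pos: "0 < rvec (x - y) \<bullet> \<alpha>"
    by (simp add: rvec_inner algebra_simps sum_subtractf)
  define \<beta> where "\<beta> = (\<lambda>n. (brun_vec_T ^^ n) \<alpha>)"
  have \<beta>_Suc: "\<beta> (Suc n) = brun_vec_T (\<beta> n)" for n by (simp add: \<beta>_def)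
  have \<beta>_nonneg: "\<beta> n \<in> nonneg_vecs" for n
  proof (induction n)
    case 0
    then show ?case using \<alpha> by (simp add: \<beta>_def)
  next
    case (Suc n)
    then show ?case
      using brun_vec_step[OF d Suc] infinite[of n] unfolding \<beta>_Suc by (metis \<beta>_def)
  qed
  define step_data where "step_data = (\<lambda>n a i j. i \<noteq> j \<and> 1 \<le> a \<and>
      brun_vec_B (\<beta> n) = brun_matrix a i j \<and>
      (\<forall>k. \<beta> n $ k \<le> \<beta> n $ i) \<and> (\<forall>k. k \<noteq> i \<longrightarrow> \<beta> n $ k \<le> \<beta> n $ j) \<and> 0 < \<beta> n $ j \<and>
      (\<beta> n $ i = \<beta> n $ j \<longrightarrow> a = 1) \<and> (\<forall>k. \<beta> (Suc n) $ k \<le> \<beta> n $ j) \<and>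
      (\<forall>k. \<beta> (Suc n) $ k = (if k = i then \<beta> n $ j
         else if k = j then \<beta> n $ i - real a * \<beta> n $ j else \<beta> n $ k)))"
  have "\<exists>a i j. step_data n a i j" for n
  proof -
    have "\<beta> n \<notin> axis_vecs" using infinite by (simp add: \<beta>_def)
    then show ?thesis
      unfolding step_data_def \<beta>_Suc by (rule brun_vec_step[OF d \<beta>_nonneg]) blast
  qed
  then obtain a i j where data: "step_data n (a n) (i n) (j n)" for n by metis
  have ij: "i n \<noteq> j n" and a: "1 \<le> a n" and B: "brun_vec_B (\<beta> n) = brun_matrix (a n) (i n) (j n)"
    and j_pos: "0 < \<beta> n $ j n" and tie: "\<beta> n $ i n = \<beta> n $ j n \<Longrightarrow> a n = 1" for n
    using data[of n] by (simp_all add: step_data_def)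
  have top: "\<beta> n $ k \<le> \<beta> n $ i n" and second: "k \<noteq> i n \<Longrightarrow> \<beta> n $ k \<le> \<beta> n $ j n"
    and step_le: "\<beta> (Suc n) $ k \<le> \<beta> n $ j n"
    and step: "\<beta> (Suc n) $ k = (if k = i n then \<beta> n $ j n
         else if k = j n then \<beta> n $ i n - real (a n) * \<beta> n $ j n else \<beta> n $ k)" for n k
    using data[of n] unfolding step_data_def by blast+
  let ?M = "\<lambda>n. incidence_matrix (brun_subst_inv (a n) (i n) (j n))"
  let ?B = "\<lambda>n. brun_matrix (a n) (i n) (j n)"
  \<comment> \<open>\<open>L n\<close> encodes the \<open>n\<close>-th iterate of the surface;
    equality of the expansions forces the surface to use the parameters found for \<alpha>.\<close>
  define L where "L = rec_nat A (\<lambda>n X. {x. ?M n *v x \<in> X})"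
  have L_0: "L 0 = A" and L_Suc: "L (Suc n) = {x. ?M n *v x \<in> L n}" for n
    by (simp_all add: L_def)
  have choice: "brun_choice (stepped_of (L n)) = Some (a n, i n, j n)"
    if "down_closed (L n)" "(brun_surf_T ^^ n) (stepped_of A) = stepped_of (L n)" for n
  proof (rule brun_choice_of_expansion[OF _ ij a that(2,1)])
    show "brun_surf_expansion (stepped_of A) (Suc n) = ?B n"
      using S by (simp add: same_expansion_surfaces_def brun_vec_expansion_def B[unfolded \<beta>_def])
  qed
  have L: "down_closed (L n) \<and> (brun_surf_T ^^ n) (stepped_of A) = stepped_of (L n)" for n
  proof (induction n)
    case 0
    then show ?case using A by (simp add: L_0)
  next
    case (Suc n)
    then have "brun_choice (stepped_of (L n)) = Some (a n, i n, j n)" using choice by blast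
    then show ?case
      using brun_choice_stepped_of(3,4)[of "L n" "a n" "i n" "j n"] Suc by (simp add: L_Suc)
  qed
  have j_rec: "axis k 1 - axis (j n) 1 \<in> recession (L n)" if "k \<noteq> i n" "k \<noteq> j n" for k n
    using brun_choice_stepped_of(2)[of "L n", OF _ choice] L that by blast
  \<comment> \<open>The Brun matrices undo the pullbacks that define \<open>L\<close>, so
    \<open>orb z n\<close> lies in \<open>L n\<close> exactly when \<open>z\<close> lies in
    \<open>A\<close>.\<close>
  define orb where "orb = (\<lambda>z. rec_nat z (\<lambda>n v. ?B n *v v))"
  have orb_0: "orb z 0 = z" and orb_Suc: "orb z (Suc n) = ?B n *v orb z n" for z n
    by (simp_all add: orb_def)
  have orb_diff: "orb (x - y) n = orb x n - orb y n" for n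
    by (induction n) (simp_all add: orb_0 orb_Suc matrix_vector_mult_diff_distrib)
  have orb_mem: "orb z n \<in> L n \<longleftrightarrow> z \<in> A" for z n
    by (induction n) (simp_all add: orb_0 orb_Suc L_0 L_Suc ij incidence_brun_subst_inv_mult_brun_matrix)
  define v where "v = orb (x - y)"
  have v_inner: "0 < rvec (v n) \<bullet> \<beta> n" for n
  proof (induction n)
    case 0
    then show ?case using pos by (simp add: v_def orb_0 \<beta>_def)
  next
    case (Suc n)
    then show ?case
      using brun_matrix_inner_invariant[OF ij step] by (simp add: v_def orb_Suc)
  qed
  have \<beta>_nn: "0 \<le> \<beta> n $ k" for n k using \<beta>_nonneg[of n] by (simp add: nonneg_vecs_def)
  have i_pos: "0 < \<beta> n $ i n" for n using j_pos[of n] top[of n "j n"] by simp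
  \<comment> \<open>A zero entry is neither at \<open>i n\<close> nor at \<open>j n\<close>, where
    entries are positive, so it is left unchanged. Supports can only shrink and are constant from
    some \<open>N\<close> on.\<close>
  have zeros_mono: "{k. \<beta> n $ k = 0} \<subseteq> {k. \<beta> (Suc n) $ k = 0}" for n
    using i_pos[of n] j_pos[of n] by (auto simp: step)
  obtain N where N: "\<And>n. {k. \<beta> (N + n) $ k = 0} = {k. \<beta> N $ k = 0}"
    by (rule eventually_constant_finite_chain[of "\<lambda>n. {k. \<beta> n $ k = 0}", OF zeros_mono]) blast
  define P where "P = {k. \<beta> N $ k \<noteq> 0}"
  have P: "k \<in> P \<longleftrightarrow> 0 < \<beta> (N + n) $ k" for k n
  proof -
    have "k \<in> P \<longleftrightarrow> \<beta> (N + n) $ k \<noteq> 0" using N[of n] by (auto simp: P_def)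
    then show ?thesis using \<beta>_nn[of "N + n" k] by auto
  qed
  \<comment> \<open>A tie between the two largest entries makes one of them vanish in the next step.\<close>
  have no_tie: "\<beta> (N + n) $ j (N + n) < \<beta> (N + n) $ i (N + n)" for n
  proof (rule ccontr)
    assume "\<not> ?thesis"
    then have eq: "\<beta> (N + n) $ i (N + n) = \<beta> (N + n) $ j (N + n)"
      using top[of "N + n" "j (N + n)"] by simp
    then have "\<beta> (N + Suc n) $ j (N + n) = 0"
      using tie[OF eq] step[of "N + n" "j (N + n)"] ij[of "N + n"] by simp
    then show False using P[of "j (N + n)"] j_pos[of "N + n"] by (metis less_irrefl)
  qed
  have i_const: "i (N + n) = i N" for n
  proof (induction n)
    case (Suc n)
    let ?m = "N + n"
    \<comment> \<open>After the step the old top index holds \<open>\<beta> ?m $ j ?m\<close>, an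
      upper bound for all entries. A different top index would then tie with the second largest
      entry.\<close>
    have "i (Suc ?m) = i ?m"
    proof (rule ccontr)
      assume neq: "i (Suc ?m) \<noteq> i ?m"
      have "\<beta> (Suc ?m) $ i (Suc ?m) \<le> \<beta> ?m $ j ?m"
        by (rule step_le)
      moreover have "\<beta> (Suc ?m) $ i ?m = \<beta> ?m $ j ?m" by (simp add: step)
      moreover have "\<beta> (Suc ?m) $ i ?m \<le> \<beta> (Suc ?m) $ j (Suc ?m)"
        using neq second[of "i ?m" "Suc ?m"] by simp
      ultimately show False using no_tie[of "Suc n"] by simp
    qed
    then show ?case using Suc by simp
  qed simp
  interpret fixed_top_brun "i N" P "\<lambda>n. a (N + n)" "\<lambda>n. j (N + n)" "\<lambda>n k. \<beta> (N + n) $ k"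
  proof
    fix n k
    show "finite P" by simp
    show "i N \<in> P" using P[of _ 0] i_pos[of N] by simp
    show "j (N + n) \<in> P" using P j_pos by blast
    show "j (N + n) \<noteq> i N" using ij[of "N + n"] i_const[of n] by simp
    show "1 \<le> a (N + n)" by (rule a)
    show "0 < \<beta> (N + n) $ k" if "k \<in> P" using P that by blast
    show "\<beta> (N + n) $ k \<le> \<beta> (N + n) $ j (N + n)" if "k \<in> P" "k \<noteq> i N"
      using second[of k "N + n"] that i_const by simp
    show "\<beta> (N + Suc n) $ k = (if k = i N then \<beta> (N + n) $ j (N + n)
      else if k = j (N + n) then \<beta> (N + n) $ i N - real (a (N + n)) * \<beta> (N + n) $ j (N + n)
      else \<beta> (N + n) $ k)"
      using step[of "N + n" k] i_const[of n] by simp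
  qed
  have v_Suc: "v (Suc n) $ k = (if k = i n then int (a n) * v n $ i n + v n $ j n
      else if k = j n then v n $ i n else v n $ k)" for n k
    by (simp add: v_def orb_Suc brun_matrix_mult_nth[OF ij])
  have "dual_orbit (\<lambda>n k. of_int (v (N + n) $ k))"
    unfolding dual_orbit_def by (simp add: v_Suc i_const)
  moreover have "0 < (\<Sum>k\<in>P. \<beta> (N + 0) $ k * of_int (v (N + 0) $ k))"
  proof -
    have "rvec (v N) \<bullet> \<beta> N = (\<Sum>k\<in>P. of_int (v N $ k) * \<beta> N $ k)"
      unfolding rvec_inner by (intro sum.mono_neutral_right) (auto simp: P_def)
    then show ?thesis using v_inner[of N] by (simp add: mult.commute)
  qed
  \<comment> \<open>The bound asked for is the total size of \<open>v\<close> off \<open>P\<close>,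
    where \<open>v\<close> no longer changes after time \<open>N\<close>.\<close>
  ultimately obtain n where
    n: "\<forall>k\<in>P. of_int (\<Sum>k\<in>-P. \<bar>v N $ k\<bar>) \<le> (of_int (v (N + n) $ k) :: real)"
    using dual_orbit_large by blast
  define m where "m = N + n"
  have inactive: "v (N + l) $ k = v N $ k" if "k \<notin> P" for k l
  proof (induction l)
    case (Suc l)
    have "k \<noteq> i (N + l)" "k \<noteq> j (N + l)" using that P i_pos j_pos by blast+
    then show ?case using Suc by (simp add: v_Suc)
  qed simp
  \<comment> \<open>This recession vector raises each coordinate off \<open>P\<close> by the size of
    \<open>v m\<close> there, at the expense of coordinate \<open>j m\<close> alone, where
    \<open>v m\<close> is large enough to pay for the total. Hence \<open>w\<close> dominates
    \<open>- v m\<close>.\<close>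
  define w where "w = (\<Sum>k\<in>-P. int (nat \<bar>v m $ k\<bar>) *s (axis k 1 - axis (j m) 1))"
  have jm: "j m \<in> P" unfolding m_def using P j_pos by blast
  have w_rec: "w \<in> recession (L m)"
    unfolding w_def
  proof (intro recession_sum recession_scale j_rec)
    fix k assume "k \<in> - P"
    then show "k \<noteq> i m" "k \<noteq> j m" using P[of k n] i_pos[of m] j_pos[of m] by (auto simp: m_def)
  qed
  have w_nth: "w $ l = (if l \<in> P then if l = j m then - (\<Sum>k\<in>-P. \<bar>v m $ k\<bar>) else 0
      else \<bar>v m $ l\<bar>)" for l
  proof -
    have "w $ l = (\<Sum>k\<in>-P. (if k = l then \<bar>v m $ l\<bar> else 0) - (if l = j m then \<bar>v m $ k\<bar> else 0))"
      unfolding w_def sum_component by (intro sum.cong) (auto simp: axis_def)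
    then show ?thesis using jm by (auto simp: sum_subtractf sum_negf)
  qed
  have "orb y m \<in> L m"
  proof (rule down_closedD)
    show "down_closed (L m)" using L by blast
    show "orb x m + w \<in> L m" using recessionD[OF w_rec] orb_mem x by blast
    fix k
    have sum_eq: "(\<Sum>k\<in>-P. \<bar>v m $ k\<bar>) = (\<Sum>k\<in>-P. \<bar>v N $ k\<bar>)"
      by (intro sum.cong) (simp_all add: m_def inactive)
    have ge: "(\<Sum>k\<in>-P. \<bar>v m $ k\<bar>) \<le> v m $ k" if "k \<in> P"
      unfolding sum_eq using n that unfolding m_def of_int_le_iff by blast
    have "0 \<le> (\<Sum>k\<in>-P. \<bar>v m $ k\<bar>)" by (simp add: sum_nonneg)
    then have "0 \<le> v m $ k" if "k \<in> P" using ge[OF that] by linarith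
    then have "- v m $ k \<le> w $ k" using ge by (auto simp: w_nth)
    then show "orb y m $ k \<le> (orb x m + w) $ k" by (simp add: v_def orb_diff)
  qed
  then show False using orb_mem y by blast
qed

theorem theorem5p15:
  fixes \<alpha> :: "real^'d::{finite,wellorder}"
  assumes "CARD('d) \<ge> 3"
    and "\<alpha> \<in> nonneg_vecs"
  shows "\<forall>\<epsilon>>0. \<exists>N::nat. enat N \<le> brun_vec_length \<alpha> \<longrightarrow>
    (\<forall>\<S>\<in>same_expansion_surfaces \<alpha>. \<exists>\<Q>. stepped_quasi_plane \<alpha> \<Q> \<and> dist_stepped \<S> \<Q> \<le> \<epsilon>)"
proof (cases "\<exists>n. (brun_vec_T ^^ n) \<alpha> \<in> axis_vecs")
  case True
  then obtain l where "brun_vec_length \<alpha> = enat l" by (simp add: brun_vec_length_def)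
  \<comment> \<open>For a finite length \<open>l\<close>, the choice \<open>Suc l\<close> makes the
    hypothesis on the length false.\<close>
  then show ?thesis by (intro allI impI exI[of _ "Suc l"]) simp
next
  case False
  have "stepped_quasi_plane \<alpha> \<S>" if S: "\<S> \<in> same_expansion_surfaces \<alpha>" for \<S>
  proof -
    have surf: "stepped_surface \<S>" using S by (simp add: same_expansion_surfaces_def)
    then obtain A where A: "down_closed A" "A \<noteq> {}" "A \<noteq> UNIV" "\<S> = stepped_of A"
      using stepped_surface_lower_set by blast
    show ?thesis
      unfolding A(4)
    proof (rule stepped_quasi_planeI)
      show "0 \<le> \<alpha> $ i" for i using assms(2) by (simp add: nonneg_vecs_def)
      show "rvec x \<bullet> \<alpha> \<le> rvec y \<bullet> \<alpha>" if "x \<in> A" "y \<notin> A" for x y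
        using same_expansion_separated[OF _ assms(2) _ _ A(1) that] assms(1) False S A(4) by simp
    qed (use A surf in auto)
  qed
  \<comment> \<open>The surface serves as its own quasi-plane, at distance 0.\<close>
  then have close: "\<exists>\<Q>. stepped_quasi_plane \<alpha> \<Q> \<and> dist_stepped \<S> \<Q> \<le> \<epsilon>"
    if "\<S> \<in> same_expansion_surfaces \<alpha>" "0 < \<epsilon>" for \<S> \<epsilon>
    using that by (intro exI[of _ \<S>]) (simp add: dist_stepped_def)
  show ?thesis by (intro allI impI exI[of _ "0::nat"] ballI close)
qed

end
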